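(* Let $s=\sigma+it\in\mathbb{C}$ with $0\le\sigma\le 1$ and $t\in\mathbb{R}$, and let $c$ be a real number with $c<-3/2$. Then $$\xi(s)=\frac{\pi^{1/4}}{2\,\Gamma(3/4)}-J(s,c).$$
   Context: $\zeta$ is the Riemann zeta function, $\Gamma$ the Gamma function, and $\xi$ is Riemann's function $\xi(s)=(s-1)\,\pi^{-s/2}\,\zeta(s)\,\Gamma(1+s/2)$ (an entire function, with removable singularities filled in), which satisfies $\xi(s)=\xi(1-s)$. For complex $s$ and real $c$, $$J(s,c)=\int_{-\infty}^{\infty}\pi^{c-iv}\,\zeta(-2c+2iv-2)\,\Gamma(-c+iv)\,M(c,s,v)\,dv,$$ $$M(c,s,v)=\frac{-(2s-1)^2/2+2iv-2(c+5/4)}{-(2s-1)^2/4+2i\bigl(2iv-4(c+5/4)\bigr)v+4(c+5/4)^2}.$$ *)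

theory Defs
  imports "HOL-Complex_Analysis.Complex_Analysis"
begin

text \<open>
  The Riemann zeta function is the analytic continuation of its Dirichlet series to the
  punctured plane. The value at the pole \<open>1\<close> is a pure convention, needed only for the
  definite description to be unique.
\<close>

definition zeta :: "complex \<Rightarrow> complex" where
  "zeta = (THE f. f holomorphic_on (- {1}) \<and>
                  (\<forall>s. Re s > 1 \<longrightarrow> f s = (\<Sum>n. 1 / of_nat (Suc n) powr s)) \<and>
                  f 1 = 0)"

text \<open>
  The singularities removed here are \<open>s = 1\<close> (pole of zeta) and the negative even integers
  (poles of the Gamma factor).
\<close>

definition xi :: "complex \<Rightarrow> complex" where
  "xi = remove_sings
          (\<lambda>s. (s - 1) * of_real pi powr (- s / 2) * zeta s * Gamma (1 + s / 2))"

definition M_fun :: "real \<Rightarrow> complex \<Rightarrow> real \<Rightarrow> complex" where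
  "M_fun c s v =
     (- (2 * s - 1)\<^sup>2 / 2 + 2 * \<i> * of_real v - 2 * (of_real c + 5 / 4)) /
     (- (2 * s - 1)\<^sup>2 / 4
        + 2 * \<i> * (2 * \<i> * of_real v - 4 * (of_real c + 5 / 4)) * of_real v
        + 4 * (of_real c + 5 / 4)\<^sup>2)"

definition J_integrand :: "complex \<Rightarrow> real \<Rightarrow> real \<Rightarrow> complex" where
  "J_integrand s c v =
     of_real pi powr (of_real c - \<i> * of_real v) *
     zeta (- 2 * of_real c + 2 * \<i> * of_real v - 2) *
     Gamma (- of_real c + \<i> * of_real v) * M_fun c s v"

definition J :: "complex \<Rightarrow> real \<Rightarrow> complex" where
  "J s c = (LBINT v. J_integrand s c v)"

end

theory Submission
  imports Defs "HOL-Probability.Characteristic_Functions"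
begin

text \<open>
  Put \<open>w = - c + \<i> v\<close>. The integrand of \<open>J\<close> is \<open>\<pi>\<^bsup>-w\<^esup> zeta (2 w - 2) Gamma w M\<close>, where
  \<open>M = s / (2 w - 3 + s) + (1 - s) / (2 w - 2 - s)\<close>, and on the line of integration zeta is its Dirichlet
  series. For a single \<open>n\<close>, Mellin inversion of Euler's integral says that
  \<open>\<integral> Gamma w x\<^bsup>-w\<^esup> dv = 2 \<pi> exp (- x)\<close> (\<open>Gamma_mellin_inversion\<close>), and \<open>M\<close> is a Laplace transform
  of exponentials (\<open>M_fun_eq_integral\<close>). So every term of the series becomes an integral of
  \<open>exp (- \<pi> n\<^sup>2 x)\<close> over \<open>x \<ge> 1\<close>. Integrating by parts and summing over \<open>n\<close> yields, with
  \<open>psi x = (\<Sum>n\<ge>1. exp (- \<pi> n\<^sup>2 x))\<close>,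
  \<open>J = psi 1 + s (1 - s) / 2 * \<integral> psi x (x powr (s / 2 - 1) + x powr ((1 - s) / 2 - 1)) dx\<close>
  over \<open>x \<ge> 1\<close> (\<open>J_closed_form\<close>).

  On the other side, Riemann's argument, the Mellin transform of the theta function folded by the
  functional equation (\<open>theta_functional_equation\<close>, \<open>theta_mellin\<close>), shows that \<open>xi s\<close> is \<open>1 / 2\<close>
  minus the same multiple of the same integral (\<open>zeta_eq_zeta_cont\<close>, \<open>xi_eq_xi_entire\<close>). Adding
  the two, the integrals cancel and \<open>xi s + J s c = 1 / 2 + psi 1 = theta 1 / 2\<close>.

  It remains to know that \<open>theta 1 = \<pi> powr (1 / 4) / Gamma (3 / 4)\<close> (\<open>theta_at_1\<close>). The squares of two of
  Jacobi's theta functions undergo an arithmetic-geometric mean step when the argument is doubled and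
  tend to \<open>1\<close>, so Gauss's elliptic integral with these squares as parameters equals \<open>\<pi>\<close>. At
  argument \<open>1\<close> the functional equation fixes their ratio to be \<open>sqrt 2\<close>, and for that ratio the
  elliptic integral is a Beta integral.
\<close>

section \<open>Fourier inversion and the Gamma function on vertical lines\<close>

lemma fourier_gaussian:
  fixes e u :: real
  assumes e: "e > 0"
  shows "integrable lborel (\<lambda>t. iexp (t * u) * of_real (exp (- ((e * t)\<^sup>2 / 2))))"
    and "(LBINT t. iexp (t * u) * of_real (exp (- ((e * t)\<^sup>2 / 2)))) =
         of_real (sqrt (2 * pi) / e * exp (- ((u / e)\<^sup>2 / 2)))"
proof -
  have std: "has_bochner_integral lborel (\<lambda>x. iexp (v * x) * of_real (exp (- (x\<^sup>2 / 2))))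
               (of_real (sqrt (2 * pi) * exp (- (v\<^sup>2 / 2))))" for v :: real
  proof -
    have int: "integrable lborel (\<lambda>x. std_normal_density x *\<^sub>R iexp (v * x))"
      using integrable_normal_density[of 1 0]
      by (rule Bochner_Integration.integrable_bound) (auto simp: norm_mult)
    have "of_real (exp (- (v\<^sup>2) / 2)) = (LINT x|std_normal_distribution. iexp (v * x))"
      using fun_cong[OF char_std_normal_distribution, of v] by (simp add: char_def)
    also have "\<dots> = (LBINT x. std_normal_density x *\<^sub>R iexp (v * x))"
      by (subst integral_density) auto
    finally have "has_bochner_integral lborel (\<lambda>x. std_normal_density x *\<^sub>R iexp (v * x))
                    (of_real (exp (- (v\<^sup>2) / 2)))"
      using int by (simp add: has_bochner_integral_iff)
    from has_bochner_integral_mult_right[OF this, of "of_real (sqrt (2 * pi))"]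
    have "has_bochner_integral lborel (\<lambda>x. of_real (sqrt (2 * pi)) * (std_normal_density x *\<^sub>R iexp (v * x)))
            (of_real (sqrt (2 * pi) * exp (- (v\<^sup>2 / 2))))" by simp
    moreover have "of_real (sqrt (2 * pi)) * (std_normal_density x *\<^sub>R iexp (v * x)) =
            iexp (v * x) * of_real (exp (- (x\<^sup>2 / 2)))" for x
    proof -
      have "sqrt (2 * pi) * std_normal_density x = exp (- (x\<^sup>2 / 2))"
        by (simp add: std_normal_density_def)
      then have "complex_of_real (sqrt (2 * pi)) * of_real (std_normal_density x) = of_real (exp (- (x\<^sup>2 / 2)))"
        by (simp only: flip: of_real_mult)
      then show ?thesis by (simp add: scaleR_conv_of_real mult_ac)
    qed
    ultimately show ?thesis by simp
  qed
  have "has_bochner_integral lborel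
          (\<lambda>t. iexp (u / e * (0 + e * t)) * of_real (exp (- ((0 + e * t)\<^sup>2 / 2))))
          (of_real (sqrt (2 * pi) * exp (- ((u / e)\<^sup>2 / 2))) /\<^sub>R \<bar>e\<bar>)"
    using e std[of "u / e"] by (subst lborel_has_bochner_integral_real_affine_iff[symmetric]) auto
  moreover have "u / e * (0 + e * t) = t * u" "0 + e * t = e * t" for t using e by auto
  moreover have "of_real (sqrt (2 * pi) * exp (- ((u / e)\<^sup>2 / 2))) /\<^sub>R \<bar>e\<bar> =
      complex_of_real (sqrt (2 * pi) / e * exp (- ((u / e)\<^sup>2 / 2)))"
    using e by (simp add: scaleR_conv_of_real field_simps)
  ultimately have "has_bochner_integral lborel
          (\<lambda>t. iexp (t * u) * of_real (exp (- ((e * t)\<^sup>2 / 2))))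
          (of_real (sqrt (2 * pi) / e * exp (- ((u / e)\<^sup>2 / 2))))"
    by (simp only:)
  then show "integrable lborel (\<lambda>t. iexp (t * u) * of_real (exp (- ((e * t)\<^sup>2 / 2))))"
    and "(LBINT t. iexp (t * u) * of_real (exp (- ((e * t)\<^sup>2 / 2)))) =
         of_real (sqrt (2 * pi) / e * exp (- ((u / e)\<^sup>2 / 2)))"
    by (auto simp: has_bochner_integral_iff)
qed

text \<open>
  Inserting the factor \<open>exp (- (e t)\<^sup>2 / 2)\<close> makes the double integral absolutely convergent. After
  exchanging the order of integration the inner integral is a Gaussian of width \<open>e\<close> centred at
  \<open>x\<close>, and letting \<open>e\<close> tend to \<open>0\<close> gives the claim by dominated convergence on both sides.
\<close>

lemma fourier_inversion:
  fixes f :: "real \<Rightarrow> complex"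
  assumes int: "integrable lborel f" and cont: "continuous_on UNIV f"
    and bnd: "\<And>y. norm (f y) \<le> C"
    and int': "integrable lborel (\<lambda>t. LBINT y. iexp (t * y) * f y)"
  shows "(LBINT t. iexp (- (t * x)) * (LBINT y. iexp (t * y) * f y)) = 2 * pi * f x"
proof -
  define \<phi> where "\<phi> t = (LBINT y. iexp (t * y) * f y)" for t
  define e where "e n = 1 / real (Suc n)" for n
  have e: "e n > 0" for n by (simp add: e_def)
  have e0: "e \<longlonglongrightarrow> 0" unfolding e_def
    using LIMSEQ_inverse_real_of_nat by (simp add: inverse_eq_divide)
  have [measurable]: "f \<in> borel_measurable borel"
    using cont by (rule borel_measurable_continuous_onI)
  have [measurable]: "\<phi> \<in> borel_measurable borel"
    using int' by (simp add: \<phi>_def[abs_def] borel_measurable_integrable)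
  define L where "L n = (LBINT t. iexp (- (t * x)) * \<phi> t * of_real (exp (- ((e n * t)\<^sup>2 / 2))))" for n
  have lim1: "L \<longlonglongrightarrow> (LBINT t. iexp (- (t * x)) * \<phi> t)"
    unfolding L_def
  proof (rule integral_dominated_convergence)
    show "integrable lborel (\<lambda>t. norm (\<phi> t))" using int' by (simp add: \<phi>_def[abs_def])
    have "(\<lambda>n. iexp (- (t * x)) * \<phi> t * of_real (exp (- ((e n * t)\<^sup>2 / 2)))) \<longlonglongrightarrow>
           iexp (- (t * x)) * \<phi> t * of_real (exp (- ((0 * t)\<^sup>2 / 2)))" for t
      by (intro tendsto_intros e0) auto
    then show "AE t in lborel. (\<lambda>n. iexp (- (t * x)) * \<phi> t * of_real (exp (- ((e n * t)\<^sup>2 / 2)))) \<longlonglongrightarrow>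
           iexp (- (t * x)) * \<phi> t" by simp
  qed (auto simp: norm_mult mult_left_le)
  have L: "L n = sqrt (2 * pi) * (LBINT z. f (x + e n * z) * of_real (exp (- (z\<^sup>2 / 2))))" for n
  proof -
    define h where "h t y = iexp (t * (y - x)) * of_real (exp (- ((e n * t)\<^sup>2 / 2))) * f y" for t y
    have gi: "integrable lborel (\<lambda>t. exp (- ((e n * t)\<^sup>2 / 2)))"
      using integrable_norm[OF fourier_gaussian(1)[OF e[of n], of 0]] by simp
    have [measurable]: "case_prod h \<in> borel_measurable (lborel \<Otimes>\<^sub>M lborel)"
      unfolding h_def by measurable
    have nh: "norm (h t y) = exp (- ((e n * t)\<^sup>2 / 2)) * norm (f y)" for t y
      by (simp add: h_def norm_mult)
    have inth: "integrable lborel (h t)" for t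
      using integrable_mult_right[OF int, of "exp (- ((e n * t)\<^sup>2 / 2))"]
      by (rule Bochner_Integration.integrable_bound) (auto simp: nh norm_mult h_def)
    have "integrable (lborel \<Otimes>\<^sub>M lborel) (case_prod h)"
      by (rule lborel_pair.Fubini_integrable) (use gi inth in \<open>auto simp: nh\<close>)
    then have fub: "(LBINT y. LBINT t. h t y) = (LBINT t. LBINT y. h t y)"
      by (rule lborel_pair.Fubini_integral)
    have inner: "(LBINT y. h t y) = iexp (- (t * x)) * \<phi> t * of_real (exp (- ((e n * t)\<^sup>2 / 2)))" for t
    proof -
      have "h t y = (iexp (- (t * x)) * of_real (exp (- ((e n * t)\<^sup>2 / 2)))) * (iexp (t * y) * f y)" for y
      proof -
        have "iexp (t * (y - x)) = iexp (- (t * x)) * iexp (t * y)"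
          by (simp add: algebra_simps flip: exp_add)
        then show ?thesis by (simp only: h_def mult_ac)
      qed
      then have "(LBINT y. h t y) = (iexp (- (t * x)) * of_real (exp (- ((e n * t)\<^sup>2 / 2)))) * \<phi> t"
        unfolding \<phi>_def by (simp only: integral_mult_right_zero)
      then show ?thesis by (simp only: mult_ac)
    qed
    have "L n = (LBINT y. LBINT t. h t y)" by (simp only: L_def fub inner)
    also have "\<dots> = (LBINT y. of_real (sqrt (2 * pi) / e n * exp (- (((y - x) / e n)\<^sup>2 / 2))) * f y)"
      unfolding h_def integral_mult_left_zero fourier_gaussian(2)[OF e[of n]] ..
    also have "\<dots> = \<bar>e n\<bar> *\<^sub>R (LBINT z. of_real (sqrt (2 * pi) / e n * exp (- (((x + e n * z - x) / e n)\<^sup>2 / 2))) * f (x + e n * z))"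
      using e[of n] by (intro lborel_integral_real_affine) auto
    also have "(\<lambda>z. of_real (sqrt (2 * pi) / e n * exp (- (((x + e n * z - x) / e n)\<^sup>2 / 2))) * f (x + e n * z)) =
        (\<lambda>z. of_real (sqrt (2 * pi) / e n) * (f (x + e n * z) * of_real (exp (- (z\<^sup>2 / 2)))))"
      using e[of n] by (auto simp: fun_eq_iff)
    also have "\<bar>e n\<bar> *\<^sub>R (LBINT z. of_real (sqrt (2 * pi) / e n) * (f (x + e n * z) * of_real (exp (- (z\<^sup>2 / 2))))) =
        sqrt (2 * pi) * (LBINT z. f (x + e n * z) * of_real (exp (- (z\<^sup>2 / 2))))"
      using e[of n] by (simp add: scaleR_conv_of_real)
    finally show ?thesis by simp
  qed
  have gi: "integrable lborel (\<lambda>t. exp (- (t\<^sup>2 / 2)) :: real)"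
    using integrable_norm[OF fourier_gaussian(1)[of 1 0]] by simp
  have "(\<lambda>n. LBINT z. f (x + e n * z) * of_real (exp (- (z\<^sup>2 / 2)))) \<longlonglongrightarrow>
        (LBINT z. f x * of_real (exp (- (z\<^sup>2 / 2))))"
  proof (rule integral_dominated_convergence)
    show "integrable lborel (\<lambda>t. C * exp (- (t\<^sup>2 / 2)) :: real)" using gi by simp
    have "(\<lambda>n. f (x + e n * z)) \<longlonglongrightarrow> f (x + 0 * z)" for z
    proof (rule continuous_on_tendsto_compose[OF cont])
      show "(\<lambda>n. x + e n * z) \<longlonglongrightarrow> x + 0 * z" by (intro tendsto_intros e0)
    qed auto
    then show "AE z in lborel. (\<lambda>n. f (x + e n * z) * of_real (exp (- (z\<^sup>2 / 2)))) \<longlonglongrightarrow>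
                f x * of_real (exp (- (z\<^sup>2 / 2)))"
      by (auto intro!: tendsto_intros)
  qed (auto simp: norm_mult intro!: mult_right_mono bnd)
  also have "(LBINT z. f x * of_real (exp (- (z\<^sup>2 / 2)))) = f x * sqrt (2 * pi)"
    using fourier_gaussian(2)[of 1 0] by simp
  finally have "L \<longlonglongrightarrow> sqrt (2 * pi) * (f x * sqrt (2 * pi))"
    unfolding L by (intro tendsto_intros)
  with lim1 have "(LBINT t. iexp (- (t * x)) * \<phi> t) = sqrt (2 * pi) * (f x * sqrt (2 * pi))"
    by (rule LIMSEQ_unique)
  also have "\<dots> = of_real (sqrt (2 * pi) * sqrt (2 * pi)) * f x" by (simp only: of_real_mult mult_ac)
  also have "\<dots> = 2 * pi * f x" by simp
  finally show ?thesis by (simp add: \<phi>_def)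
qed

text \<open>
  Euler's integral after the substitution \<open>x = exp y\<close>. In this form \<open>v \<mapsto> Gamma (a + \<i> v)\<close> is the Fourier
  transform of \<open>y \<mapsto> exp (a y - exp y)\<close>, scaling of the argument is translation in \<open>y\<close>, and the
  theta inversion \<open>x \<mapsto> 1 / x\<close> is a reflection; all later integrals use this variable.
\<close>

lemma Gamma_integral_exp:
  assumes w: "Re w > 0"
  shows "integrable lborel (\<lambda>y. exp (w * of_real y - of_real (exp y)))"
    and "(LBINT y. exp (w * of_real y - of_real (exp y))) = Gamma w"
proof -
  define F where "F y = exp (w * of_real y - of_real (exp y))" for y :: real
  have powr: "complex_of_real x powr (w - 1) / of_real (exp x) = (1 / x) *\<^sub>R F (ln x)" if "x > 0" for x
    using that by (auto simp: powr_def F_def exp_diff scaleR_conv_of_real Ln_of_real exp_of_real left_diff_distrib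
        mult_ac simp flip: of_real_exp)
  have ei: "einterval 0 \<infinity> = {0<..}" "einterval (-\<infinity>) \<infinity> = UNIV" by (auto simp: einterval_def)
  have sint: "set_integrable lborel {0<..} (\<lambda>x. (1 / x) *\<^sub>R F (ln x))"
  proof -
    have "set_integrable lebesgue {0<..} (\<lambda>x. complex_of_real x powr (w - 1) / of_real (exp x))"
      using absolutely_integrable_Gamma_integral'[OF w] .
    then have "set_integrable lebesgue {0<..} (\<lambda>x. (1 / x) *\<^sub>R F (ln x))"
      by (subst (asm) set_integrable_cong[OF refl refl powr]) auto
    moreover have "(\<lambda>x. indicator {0<..} x *\<^sub>R ((1 / x) *\<^sub>R F (ln x))) \<in> borel_measurable lborel"
      unfolding F_def by measurable
    ultimately show ?thesis
      unfolding set_integrable_def by (subst (asm) integrable_completion) auto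
  qed
  have tl0: "((ereal \<circ> ln \<circ> real_of_ereal) \<longlongrightarrow> -\<infinity>) (at_right 0)"
    unfolding zero_ereal_def by (simp only: ereal_tendsto_simps ln_at_0)
  have tl1: "((ereal \<circ> ln \<circ> real_of_ereal) \<longlongrightarrow> \<infinity>) (at_left \<infinity>)"
    by (simp only: ereal_tendsto_simps ln_at_top)
  have "set_integrable lborel (einterval (-\<infinity>) \<infinity>) (\<lambda>y. norm (F y))"
  proof (rule interval_integral_substitution_nonneg(1)[where g = ln and g' = "\<lambda>x. 1 / x" and a = 0 and b = \<infinity>])
    show "set_integrable lborel (einterval 0 \<infinity>) (\<lambda>x. norm (F (ln x)) * (1 / x))"
      unfolding ei using set_integrable_norm[OF sint]
      by (rule set_integrable_cong[THEN iffD1, rotated -1]) auto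
  qed (use tl0 tl1 in \<open>auto simp: F_def zero_ereal_def intro!: derivative_eq_intros continuous_intros\<close>)
  then have "integrable lborel (\<lambda>y. norm (F y))"
    by (simp add: ei set_integrable_def)
  moreover have "F \<in> borel_measurable lborel" unfolding F_def by measurable
  ultimately have iF: "integrable lborel F" by (rule integrable_norm_cancel)
  then show "integrable lborel (\<lambda>y. exp (w * of_real y - of_real (exp y)))"
    by (simp add: F_def[abs_def])
  have "(LBINT y. F y) = (LBINT y=-\<infinity>..\<infinity>. F y)"
    by (simp add: interval_lebesgue_integral_def ei set_lebesgue_integral_def)
  also have "\<dots> = (LBINT x=0..\<infinity>. (1 / x) *\<^sub>R F (ln x))"
  proof (rule interval_integral_substitution_integrable)
    show "set_integrable lborel (einterval 0 \<infinity>) (\<lambda>x. (1 / x) *\<^sub>R F (ln x))"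
      using sint by (simp add: ei)
    show "set_integrable lborel (einterval (-\<infinity>) \<infinity>) F"
      using iF by (simp add: ei set_integrable_def)
  qed (use tl0 tl1 in \<open>auto simp: F_def zero_ereal_def intro!: derivative_eq_intros continuous_intros\<close>)
  also have "\<dots> = (LBINT x:{0<..}. (1 / x) *\<^sub>R F (ln x))"
    by (simp add: interval_lebesgue_integral_def ei)
  also have "\<dots> = integral {0<..} (\<lambda>x. (1 / x) *\<^sub>R F (ln x))"
    by (rule set_borel_integral_eq_integral[OF sint])
  also have "\<dots> = integral {0<..} (\<lambda>x. complex_of_real x powr (w - 1) / of_real (exp x))"
    by (intro integral_cong) (simp add: powr)
  also have "\<dots> = Gamma w"
    using Gamma_integral_complex'[OF w] by (rule integral_unique)
  finally show "(LBINT y. exp (w * of_real y - of_real (exp y))) = Gamma w"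
    by (simp add: F_def)
qed

section \<open>The functional equation of the theta function\<close>

definition theta :: "real \<Rightarrow> real" where
  "theta x = (\<Sum>\<^sub>\<infinity>n::int. exp (- (pi * x * (of_int n)\<^sup>2)))"

lemma summable_on_int_even:
  fixes f :: "int \<Rightarrow> real"
  assumes "\<And>n. f n \<ge> 0" and "summable (\<lambda>n. f (int n))" and "\<And>n. f (- n) = f n"
  shows "f summable_on UNIV"
proof -
  have U: "(UNIV :: int set) = range int \<union> range (\<lambda>n. - int n)"
    by (auto simp: image_iff) (metis int_cases2)
  have "(\<lambda>n. f (int n)) summable_on UNIV"
    using assms by (subst summable_on_UNIV_nonneg_real_iff) auto
  then have "f summable_on range int" "f summable_on range (\<lambda>n. - int n)"
    using assms(3) by (subst summable_on_reindex; auto simp: inj_on_def o_def)+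
  then show ?thesis unfolding U by (rule summable_on_union)
qed

lemma summable_on_gauss:
  assumes x: "(x::real) > 0"
  shows "(\<lambda>n::int. exp (- (x * (of_int n)\<^sup>2))) summable_on UNIV"
proof (rule summable_on_int_even)
  show "summable (\<lambda>n. exp (- (x * (of_int (int n))\<^sup>2)))"
  proof (rule summable_comparison_test'[where g = "\<lambda>n. exp (- x) ^ n" and N = 0])
    show "summable (\<lambda>n. exp (- x) ^ n)" using x by (intro summable_geometric) auto
    fix n :: nat
    have "real n \<le> (real n)\<^sup>2" by (cases n) (auto simp: power2_eq_square)
    then show "norm (exp (- (x * (of_int (int n))\<^sup>2))) \<le> exp (- x) ^ n"
      using x by (simp flip: exp_of_nat_mult add: mult.commute)
  qed
qed auto

text \<open>
  A summable majorant for the periodised Gaussian, uniform in the shift \<open>y\<close>: it follows from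
  \<open>n\<^sup>2 \<le> 2 (y + n)\<^sup>2 + 2 y\<^sup>2\<close>.
\<close>

lemma gauss_shift_bound:
  assumes x: "(x::real) > 0" and y: "\<bar>y\<bar> \<le> 1"
  shows "exp (- (x * (y + n)\<^sup>2)) \<le> exp x * exp (- (x / 2 * n\<^sup>2))"
proof -
  have "n\<^sup>2 \<le> 2 * (y + n)\<^sup>2 + 2 * y\<^sup>2"
    using zero_le_power2[of "n + 2 * y"] by (simp add: power2_eq_square algebra_simps)
  moreover have "y\<^sup>2 \<le> 1" using y by (simp add: abs_square_le_1)
  ultimately have "n\<^sup>2 / 2 - 1 \<le> (y + n)\<^sup>2" by simp
  then have "x * (n\<^sup>2 / 2 - 1) \<le> x * (y + n)\<^sup>2" using x by simp
  then show ?thesis by (simp flip: exp_add add: algebra_simps)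
qed

text \<open>
  By the symmetry, \<open>D\<close> is a continuous function \<open>H\<close> of \<open>cos (2 \<pi> y)\<close>. The powers of the cosine are
  combinations of the functions \<open>cos (2 \<pi> k y)\<close>, so \<open>D\<close> is orthogonal to every polynomial in
  \<open>cos (2 \<pi> y)\<close>; approximating \<open>H\<close> by polynomials (Weierstrass) shows that \<open>D\<close> is
  orthogonal to itself.
\<close>

lemma even_periodic_fourier_zero:
  fixes D :: "real \<Rightarrow> real"
  assumes cont: "continuous_on {0..1} D" and sym: "\<And>y. y \<in> {0..1} \<Longrightarrow> D (1 - y) = D y"
    and coeff: "\<And>k::int. integral {0..1} (\<lambda>y. D y * cos (2 * pi * of_int k * y)) = 0"
    and y0: "y0 \<in> {0..1}"
  shows "D y0 = 0"
proof -
  have int: "(\<lambda>y. D y * g y) integrable_on {0..1}" if "continuous_on {0..1} g" for g :: "real \<Rightarrow> real"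
    using that cont by (intro integrable_continuous_real continuous_intros)
  have cp: "integral {0..1} (\<lambda>y. D y * (cos (2 * pi * y) ^ m * cos (2 * pi * of_int k * y))) = 0" for m and k :: int
  proof (induction m arbitrary: k)
    case (Suc m)
    have e: "D y * (cos (2 * pi * y) ^ Suc m * cos (2 * pi * of_int k * y)) =
          D y * (cos (2 * pi * y) ^ m * cos (2 * pi * of_int (k + 1) * y)) / 2 +
          D y * (cos (2 * pi * y) ^ m * cos (2 * pi * of_int (k - 1) * y)) / 2" for y
    proof -
      have "cos (2 * pi * of_int k * y) * cos (2 * pi * y) =
        cos (2 * pi * of_int (k + 1) * y) / 2 + cos (2 * pi * of_int (k - 1) * y) / 2"
        by (subst cos_times_cos) (simp add: ring_distribs add_divide_distrib)
      moreover have "d * (b ^ Suc m * a) = d * (b ^ m * p) / 2 + d * (b ^ m * q) / 2"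
        if "a * b = p / 2 + q / 2" for a b d p q :: real
      proof -
        have "d * (b ^ Suc m * a) = d * b ^ m * (a * b)" by simp
        then show ?thesis unfolding that by (simp add: algebra_simps)
      qed
      ultimately show ?thesis by blast
    qed
    show ?case unfolding e
      by (subst integral_add) (auto intro!: integrable_on_divide int continuous_intros simp: Suc simp del: of_int_add of_int_diff)
  qed (use coeff in simp)
  have poly: "integral {0..1} (\<lambda>y. D y * g (cos (2 * pi * y))) = 0"
    if "real_polynomial_function g" for g :: "real \<Rightarrow> real"
  proof -
    obtain a n where g: "g = (\<lambda>x. \<Sum>i\<le>n. a i * x ^ i)"
      using \<open>real_polynomial_function g\<close> by (auto simp: real_polynomial_function_iff_sum)
    have "integral {0..1} (\<lambda>y. D y * g (cos (2 * pi * y))) =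
          integral {0..1} (\<lambda>y. \<Sum>i\<le>n. a i * (D y * cos (2 * pi * y) ^ i))"
      by (simp add: g sum_distrib_left mult_ac)
    also have "\<dots> = (\<Sum>i\<le>n. a i * integral {0..1} (\<lambda>y. D y * cos (2 * pi * y) ^ i))"
      by (subst integral_sum) (auto intro!: integrable_on_mult_right int continuous_intros)
    also have "\<dots> = 0" using cp[of _ 0] by simp
    finally show ?thesis .
  qed
  obtain C where C: "\<And>y. y \<in> {0..1} \<Longrightarrow> \<bar>D y\<bar> \<le> C"
    using compact_imp_bounded[OF compact_continuous_image[OF cont compact_Icc]] unfolding bounded_iff
    by (metis image_eqI real_norm_def)
  have C0: "C \<ge> 0" using C[of 0] by simp
  \<comment> \<open>continuous because \<open>arccos\<close> is; on \<open>{1 / 2..1}\<close> the symmetry of \<open>D\<close> compensates for the branch\<close>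
  define H where "H u = D (arccos u / (2 * pi))" for u
  have contH: "continuous_on {-1..1} H" unfolding H_def
  proof (rule continuous_on_compose2[OF cont])
    show "(\<lambda>u. arccos u / (2 * pi)) ` {-1..1} \<subseteq> {0..1}"
    proof safe
      fix u :: real assume "u \<in> {-1..1}"
      then have "0 \<le> arccos u" "arccos u \<le> pi" by (auto simp: arccos_lbound arccos_ubound)
      moreover have "pi \<le> 2 * pi" by simp
      ultimately show "arccos u / (2 * pi) \<in> {0..1}" by (auto simp: divide_le_eq)
    qed
  qed (auto intro!: continuous_intros)
  have DH: "D y = H (cos (2 * pi * y))" if "y \<in> {0..1}" for y
  proof (cases "y \<le> 1 / 2")
    case True
    then show ?thesis using that by (simp add: H_def arccos_cos)
  next
    case False
    have "cos (2 * pi * y) = cos (2 * pi * (1 - y))"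
      by (simp add: right_diff_distrib cos_diff)
    moreover have "arccos (cos (2 * pi * (1 - y))) = 2 * pi * (1 - y)"
      using that False by (intro arccos_cos) auto
    ultimately have "H (cos (2 * pi * y)) = D (1 - y)" by (simp add: H_def)
    then show ?thesis using sym that by simp
  qed
  have "integral {0..1} (\<lambda>y. D y * D y) \<le> 0 + e" if e: "e > 0" for e
  proof -
    have "e / (C + 1) > 0" using e C0 by simp
    then obtain g where g: "real_polynomial_function g" "\<And>u. u \<in> {-1..1} \<Longrightarrow> \<bar>H u - g u\<bar> < e / (C + 1)"
      using Stone_Weierstrass_real_polynomial_function[OF compact_Icc contH] by metis
    have cg: "continuous_on {0..1} (\<lambda>y. g (cos (2 * pi * y)))"
      by (rule continuous_on_compose2[OF continuous_on_polymonial_function[of g UNIV]])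
         (use g(1) in \<open>auto simp: real_polynomial_function_eq intro!: continuous_intros\<close>)
    have "integral {0..1} (\<lambda>y. D y * D y) =
          integral {0..1} (\<lambda>y. D y * D y) - integral {0..1} (\<lambda>y. D y * g (cos (2 * pi * y)))"
      using poly[OF g(1)] by simp
    also have "\<dots> = integral {0..1} (\<lambda>y. D y * (D y - g (cos (2 * pi * y))))"
      by (subst integral_diff[symmetric]) (use int cont cg in \<open>auto simp: right_diff_distrib\<close>)
    also have "\<dots> \<le> integral {0..1} (\<lambda>y::real. e)"
    proof (rule Henstock_Kurzweil_Integration.integral_le)
      fix y :: real assume y: "y \<in> {0..1}"
      have "\<bar>D y * (D y - g (cos (2 * pi * y)))\<bar> \<le> C * (e / (C + 1))"
        unfolding abs_mult using C[OF y] C0 g(2)[of "cos (2 * pi * y)"] DH[OF y]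
        by (intro mult_mono) auto
      also have "\<dots> \<le> e" using C0 e by (simp add: field_simps)
      finally show "D y * (D y - g (cos (2 * pi * y))) \<le> e" by simp
    qed (auto intro!: int continuous_intros cont cg)
    finally show ?thesis by simp
  qed
  then have "integral {0..1} (\<lambda>y. D y * D y) \<le> 0" by (rule field_le_epsilon)
  moreover have "integral {0..1} (\<lambda>y. D y * D y) \<ge> 0"
    by (intro integral_nonneg int cont) auto
  ultimately have "integral {0..1} (\<lambda>y. D y * D y) = 0" by simp
  then have "\<forall>y\<in>{0..1}. D y * D y = 0"
    by (subst (asm) integral_eq_0_iff) (auto intro!: continuous_intros cont)
  then show ?thesis using y0 by simp
qed

lemma integral_cos_int:
  "((\<lambda>y. cos (2 * pi * of_int k * y)) has_integral (if k = 0 then 1 else 0)) {0..1}"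
proof (cases "k = 0")
  case False
  have "((\<lambda>y. cos (2 * pi * of_int k * y)) has_integral
          (sin (2 * pi * of_int k * 1) / (2 * pi * of_int k) - sin (2 * pi * of_int k * 0) / (2 * pi * of_int k))) {0..1}"
    using False by (intro fundamental_theorem_of_calculus)
      (auto intro!: derivative_eq_intros simp flip: has_real_derivative_iff_has_vector_derivative)
  moreover have "sin (2 * pi * of_int k) = 0"
    using sin_zero_iff_int2[of "2 * pi * of_int k"] by (auto intro: exI[of _ "2 * k"])
  ultimately show ?thesis using False by simp
qed (use has_integral_const_real[of "1::real" 0 1] in auto)

lemma integral_cos_cos_int:
  "((\<lambda>y. cos (2 * pi * of_int m * y) * cos (2 * pi * of_int k * y)) has_integral
     ((if m = k then 1 / 2 else 0) + (if m = - k then 1 / 2 else 0))) {0..1}"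
proof -
  have e: "cos (2 * pi * of_int m * y) * cos (2 * pi * of_int k * y) =
     cos (2 * pi * of_int (m - k) * y) / 2 + cos (2 * pi * of_int (m + k) * y) / 2" for y
    by (subst cos_times_cos) (simp add: ring_distribs add_divide_distrib)
  show ?thesis unfolding e
    using has_integral_add[OF has_integral_divide[OF integral_cos_int[of "m - k"], of 2] 
       has_integral_divide[OF integral_cos_int[of "m + k"], of 2]]
    by (rule has_integral_eq_rhs) auto
qed

lemma fourier_gauss_cos:
  fixes x :: real and k :: int
  assumes x: "x > 0"
  shows "has_bochner_integral lborel (\<lambda>y. exp (- (pi * x * y\<^sup>2)) * cos (2 * pi * of_int k * y))
           (exp (- (pi * (1 / x) * (of_int k)\<^sup>2)) / sqrt x)"
proof -
  define e where "e = sqrt (2 * pi * x)"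
  have e: "e > 0" "e\<^sup>2 = 2 * pi * x" using x by (auto simp: e_def)
  have eq: "Re (iexp (t * (2 * pi * of_int k)) * of_real (exp (- ((e * t)\<^sup>2 / 2)))) =
        exp (- (pi * x * t\<^sup>2)) * cos (2 * pi * of_int k * t)" for t
    using e(2) by (simp add: Re_exp power_mult_distrib mult_ac)
  have "sqrt (2 * pi) / e = 1 / sqrt x" using x by (simp add: e_def real_sqrt_mult)
  moreover have "(2 * pi * of_int k / e)\<^sup>2 / 2 = pi * (1 / x) * (of_int k)\<^sup>2"
  proof -
    have "(2 * pi * of_int k / e)\<^sup>2 / 2 = (2 * pi * of_int k)\<^sup>2 / (2 * pi * x) / 2"
      by (simp only: power_divide e(2))
    also have "\<dots> = pi * (1 / x) * (of_int k)\<^sup>2"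
      using x by (simp add: power2_eq_square)
    finally show ?thesis .
  qed
  ultimately show ?thesis
    using fourier_gaussian[OF e(1), of "2 * pi * of_int k"] integrable_Re[OF fourier_gaussian(1)[OF e(1), of "2 * pi * of_int k"]]
      integral_Re[OF fourier_gaussian(1)[OF e(1), of "2 * pi * of_int k"]]
    unfolding eq by (simp add: has_bochner_integral_iff)
qed

text \<open>
  Unfolding: integrating a periodised function over one period amounts to integrating the original
  function over the whole line. The unordered sum is compared with the one over \<open>{-N..<N}\<close>.
\<close>

lemma has_sum_unit_integrals:
  fixes g :: "real \<Rightarrow> real"
  assumes cont: "continuous_on UNIV g" and int: "integrable lborel g"
    and sum: "((\<lambda>n::int. integral {0..1} (\<lambda>y. g (y + of_int n))) has_sum S) UNIV"
  shows "S = (LBINT y. g y)"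
proof -
  have gi: "g integrable_on {a..b}" for a b
    by (intro integrable_continuous_real continuous_on_subset[OF cont]) auto
  have shift: "integral {0..1} (\<lambda>y. g (y + of_int n)) = integral {of_int n..of_int n + 1} g" for n :: int
    using integral_shift_Icc_real[of 0 1 g "of_int n"] by (simp add: o_def add.commute)
  define Y where "Y N = {- int N..<int N}" for N
  have Y: "(\<Sum>n\<in>Y N. integral {of_int n..of_int n + 1} g) = integral {-real N..real N} g" for N
  proof (induction N)
    case (Suc N)
    have "Y (Suc N) = insert (- int N - 1) (insert (int N) (Y N))" by (auto simp: Y_def)
    then have "(\<Sum>n\<in>Y (Suc N). integral {of_int n..of_int n + 1} g) =
       integral {- real N - 1..- real N} g + (integral {real N..real N + 1} g + integral {-real N..real N} g)"
      using Suc by (simp add: Y_def)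
    also have "\<dots> = integral {-real (Suc N)..real (Suc N)} g"
    proof -
      have "{-real (Suc N)..real (Suc N)} = {- real N - 1..real N + 1}" by auto
      from this[THEN arg_cong[where f = "\<lambda>A. integral A g"]] show ?thesis
        using Henstock_Kurzweil_Integration.integral_combine[of "- real N - 1" "- real N" "real N" g, OF _ _ gi]
          Henstock_Kurzweil_Integration.integral_combine[of "- real N - 1" "real N" "real N + 1" g, OF _ _ gi]
        by linarith
    qed
    finally show ?case .
  qed (simp add: Y_def)
  have "filterlim Y (finite_subsets_at_top UNIV) sequentially"
    unfolding filterlim_finite_subsets_at_top
  proof safe
    fix X :: "int set" assume "finite X"
    then obtain b where b: "\<And>x. x \<in> X \<Longrightarrow> \<bar>x\<bar> \<le> b"
      using Max_ge[of "abs ` X"] by (meson finite_imageI image_eqI)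
    show "\<forall>\<^sub>F N in sequentially. finite (Y N) \<and> X \<subseteq> Y N \<and> Y N \<subseteq> UNIV"
      using eventually_gt_at_top[of "nat b"]
    proof eventually_elim
      case (elim N)
      then show ?case using b by (force simp: Y_def abs_le_iff)
    qed
  qed
  from filterlim_compose[OF sum[unfolded has_sum_def] this]
  have lim1: "(\<lambda>N. integral {-real N..real N} g) \<longlonglongrightarrow> S"
    by (simp add: shift Y)
  have "(\<lambda>N. LBINT y. indicator {-real N..real N} y *\<^sub>R g y) \<longlonglongrightarrow> (LBINT y. g y)"
  proof (rule integral_dominated_convergence)
    show "integrable lborel (\<lambda>y. norm (g y))" using int by simp
    show "AE y in lborel. (\<lambda>N. indicator {-real N..real N} y *\<^sub>R g y) \<longlonglongrightarrow> g y"
    proof (intro AE_I2 tendsto_eventually)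
      fix y
      show "\<forall>\<^sub>F N in sequentially. indicator {-real N..real N} y *\<^sub>R g y = g y"
        using eventually_ge_at_top[of "nat \<lceil>\<bar>y\<bar>\<rceil>"]
      proof eventually_elim
        case (elim N)
        then have "y \<in> {-real N..real N}" by (auto simp: abs_le_iff nat_le_iff ceiling_le_iff)
        then show ?case by simp
      qed
    qed
  qed (use borel_measurable_integrable[OF int] in \<open>auto simp: indicator_def\<close>)
  also have "(\<lambda>N. LBINT y. indicator {-real N..real N} y *\<^sub>R g y) = (\<lambda>N. integral {-real N..real N} g)"
    using set_borel_integral_eq_integral(2)[OF borel_integrable_atLeastAtMost'[OF continuous_on_subset[OF cont]]]
    by (simp add: set_lebesgue_integral_def)
  finally show ?thesis using lim1 LIMSEQ_unique by blast
qed

text \<open>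
  Poisson summation for the Gaussian. The periodised Gaussian \<open>F\<close> and the series \<open>G\<close> built from
  its Fourier transform are both continuous and even with period one, and they have the same cosine
  coefficients \<open>c k\<close>; hence they agree, and the value at \<open>0\<close> is the functional equation.
\<close>

theorem theta_functional_equation:
  assumes x: "x > 0"
  shows "theta (1 / x) = sqrt x * theta x"
proof -
  define f where "f y = exp (- (pi * x * y\<^sup>2))" for y
  define c where "c k = exp (- (pi * (1 / x) * (of_int k)\<^sup>2)) / sqrt x" for k :: int
  define F where "F y = (\<Sum>\<^sub>\<infinity>n::int. f (y + of_int n))" for y
  define G where "G y = (\<Sum>\<^sub>\<infinity>k. c k * cos (2 * pi * of_int k * y))" for y
  define D where "D y = F y - G y" for y
  \<comment> \<open>one majorant for all shifts by at most \<open>1\<close>\<close>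
  define M where "M n = exp (pi * x) * exp (- (pi * x / 2 * (of_int n)\<^sup>2))" for n :: int
  have M: "M summable_on UNIV" unfolding M_def
    using x by (intro summable_on_cmult_right summable_on_gauss) auto
  have c: "c summable_on UNIV"
    using summable_on_cmult_left[OF summable_on_gauss[of "pi * (1 / x)"], of "1 / sqrt x"] x
    by (simp add: c_def[abs_def])
  have fM: "f (y + of_int n) \<le> M n" if "y \<in> {-1..1}" for y n
    using gauss_shift_bound[of "pi * x" y "of_int n"] x that by (simp add: f_def M_def abs_le_iff)
  have f0: "f y \<ge> 0" for y by (simp add: f_def)
  have contf: "continuous_on A f" for A unfolding f_def by (intro continuous_intros)
  have UF: "uniform_limit {0..1} (\<lambda>Y y. \<Sum>n\<in>Y. f (y + of_int n)) F (finite_subsets_at_top UNIV)"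
    unfolding F_def by (rule Weierstrass_m_test_general[OF _ M]) (use fM f0 in auto)
  have UG: "uniform_limit {0..1} (\<lambda>Y y. \<Sum>k\<in>Y. c k * cos (2 * pi * of_int k * y)) G (finite_subsets_at_top UNIV)"
    unfolding G_def by (rule Weierstrass_m_test_general[OF _ c])
       (use x in \<open>auto simp: c_def abs_mult mult_left_le intro!: divide_right_mono\<close>)
  have contF: "continuous_on {0..1} F"
    by (rule uniform_limit_theorem[OF _ UF]) (auto intro!: always_eventually continuous_intros continuous_on_compose2[OF contf[of UNIV]])
  have contG: "continuous_on {0..1} G"
    by (rule uniform_limit_theorem[OF _ UG]) (auto intro!: always_eventually continuous_intros)
  have coefF: "((\<lambda>y. F y * cos (2 * pi * of_int k * y)) has_integral c k) {0..1}" for k :: int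
  proof -
    let ?h = "\<lambda>y. f y * cos (2 * pi * of_int k * y)"
    have per: "cos (2 * pi * of_int k * (y + of_int n)) = cos (2 * pi * of_int k * y)" for y and n :: int
      using cos_int_2pin[of "k * n"] sin_int_2pin[of "k * n"]
      by (simp add: ring_distribs cos_add mult_ac)
    have U: "uniform_limit {0..1} (\<lambda>Y y. \<Sum>n\<in>Y. ?h (y + of_int n)) (\<lambda>y. F y * cos (2 * pi * of_int k * y)) (finite_subsets_at_top UNIV)"
    proof (rule Weierstrass_m_test_general'[OF _ _ M])
      show "((\<lambda>n. ?h (y + of_int n)) has_sum F y * cos (2 * pi * of_int k * y)) UNIV" if "y \<in> {0..1}" for y
        unfolding per F_def using that fM[of y] f0
        by (intro has_sum_cmult_left has_sum_infsum summable_on_comparison_test[OF M]) auto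
      show "norm (?h (y + of_int n)) \<le> M n" if "y \<in> {0..1}" for y n
        using fM[of y n] that f0[of "y + of_int n"] order_trans[OF mult_left_le[of "\<bar>cos (2 * pi * of_int k * (y + of_int n))\<bar>" "f (y + of_int n)"]]
        by (auto simp: abs_mult)
    qed
    obtain I J where IJ: "\<And>Y. ((\<lambda>y. \<Sum>n\<in>Y. ?h (y + of_int n)) has_integral I Y) {0..1}"
       "((\<lambda>y. F y * cos (2 * pi * of_int k * y)) has_integral J) {0..1}" "(I \<longlongrightarrow> J) (finite_subsets_at_top UNIV)"
    proof -
      have "continuous_on {0..1} (\<lambda>y. \<Sum>n\<in>Y. ?h (y + of_int n))" for Y :: "int set"
        by (intro continuous_intros continuous_on_compose2[OF contf[of UNIV]]) auto
      from uniform_limit_integral[OF U this finite_subsets_at_top_neq_bot] that show ?thesis by blast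
    qed
    have "((\<lambda>n::int. integral {0..1} (\<lambda>y. ?h (y + of_int n))) has_sum J) UNIV"
      unfolding has_sum_def
    proof (rule tendsto_cong[THEN iffD1, OF _ IJ(3)], rule always_eventually, rule allI)
      fix Y :: "int set"
      have "I Y = integral {0..1} (\<lambda>y. \<Sum>n\<in>Y. ?h (y + of_int n))" using IJ(1) by (rule integral_unique[symmetric])
      also have "\<dots> = (\<Sum>n\<in>Y. integral {0..1} (\<lambda>y. ?h (y + of_int n)))"
        by (cases "finite Y", rule integral_sum)
           (auto intro!: integrable_continuous_real continuous_intros continuous_on_compose2[OF contf[of UNIV]])
      finally show "I Y = (\<Sum>n\<in>Y. integral {0..1} (\<lambda>y. ?h (y + of_int n)))" .
    qed
    then have "J = (LBINT y. ?h y)"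
      by (intro has_sum_unit_integrals) 
         (use fourier_gauss_cos[OF x, of k] in \<open>auto simp: has_bochner_integral_iff f_def intro!: continuous_intros\<close>)
    also have "\<dots> = c k" using fourier_gauss_cos[OF x, of k] by (simp add: has_bochner_integral_iff f_def c_def)
    finally show ?thesis using IJ(2) by simp
  qed
  have coefG: "((\<lambda>y. G y * cos (2 * pi * of_int k * y)) has_integral c k) {0..1}" for k :: int
  proof -
    let ?h = "\<lambda>m y. c m * cos (2 * pi * of_int m * y) * cos (2 * pi * of_int k * y)"
    have c0: "c m \<ge> 0" for m using x by (simp add: c_def)
    have h1: "\<bar>c m * cos u\<bar> \<le> c m" for m u using c0[of m] by (auto simp: abs_mult intro!: mult_left_le)
    have h2: "norm (?h m y) \<le> c m" for m y
      using order_trans[OF mult_left_le h1[of m]] by (auto simp: abs_mult)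
    have U: "uniform_limit {0..1} (\<lambda>Y y. \<Sum>m\<in>Y. ?h m y) (\<lambda>y. G y * cos (2 * pi * of_int k * y)) (finite_subsets_at_top UNIV)"
    proof (rule Weierstrass_m_test_general'[OF _ _ c])
      show "((\<lambda>m. ?h m y) has_sum G y * cos (2 * pi * of_int k * y)) UNIV" for y
        unfolding G_def using h1
        by (intro has_sum_cmult_left has_sum_infsum abs_summable_summable[OF summable_on_comparison_test[OF c]]) auto
    qed (use h2 in auto)
    obtain I J where IJ: "\<And>Y. ((\<lambda>y. \<Sum>m\<in>Y. ?h m y) has_integral I Y) {0..1}"
       "((\<lambda>y. G y * cos (2 * pi * of_int k * y)) has_integral J) {0..1}" "(I \<longlongrightarrow> J) (finite_subsets_at_top UNIV)"
    proof -
      have "continuous_on {0..1} (\<lambda>y. \<Sum>m\<in>Y. ?h m y)" for Y by (intro continuous_intros)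
      from uniform_limit_integral[OF U this finite_subsets_at_top_neq_bot] that show ?thesis by blast
    qed
    define d where "d m = c m * ((if m = k then 1 / 2 else 0) + (if m = - k then 1 / 2 else 0))" for m
    have "I Y = sum d Y" if "finite Y" for Y
      unfolding d_def using that
      by (intro has_integral_unique[OF IJ(1)[unfolded mult.assoc[of "c _"]]] has_integral_sum 
          has_integral_mult_right integral_cos_cos_int)
    then have ev: "\<forall>\<^sub>F Y in finite_subsets_at_top UNIV. I Y = sum d Y"
      using eventually_finite_subsets_at_top_weakI by fastforce
    have "(d has_sum J) UNIV"
      unfolding has_sum_def using tendsto_cong[OF ev] IJ(3) by blast
    moreover have "(d has_sum sum d {k, -k}) UNIV"
      by (rule has_sum_finite_neutralI) (auto simp: d_def)
    moreover have "sum d {k, -k} = c k"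
      by (cases "k = 0") (auto simp: d_def c_def)
    ultimately have "J = c k" using has_sum_unique by fastforce
    then show ?thesis using IJ(2) by simp
  qed
  have "D 0 = 0"
  proof (rule even_periodic_fourier_zero[of D])
    show "continuous_on {0..1} D" unfolding D_def by (intro continuous_intros contF contG)
    show "integral {0..1} (\<lambda>y. D y * cos (2 * pi * of_int k * y)) = 0" for k :: int
      using integral_unique[OF has_integral_diff[OF coefF[of k] coefG[of k]]]
      by (simp add: D_def left_diff_distrib)
    show "D (1 - y) = D y" for y
    proof -
      have "bij_betw (\<lambda>n::int. - n - 1) UNIV UNIV"
        by (rule bij_betwI[where g = "\<lambda>n. - n - 1"]) auto
      then have "F (1 - y) = (\<Sum>\<^sub>\<infinity>n::int. f (1 - y + of_int (- n - 1)))"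
        unfolding F_def by (subst infsum_reindex_bij_betw) auto
      also have "\<dots> = F y" unfolding F_def f_def by (intro infsum_cong) (simp add: power2_eq_square algebra_simps)
      finally have "F (1 - y) = F y" .
      moreover have "cos (2 * pi * of_int k * (1 - y)) = cos (2 * pi * of_int k * y)" for k :: int
        using cos_int_2pin[of k] sin_int_2pin[of k] by (simp add: right_diff_distrib cos_diff)
      then have "G (1 - y) = G y" by (simp add: G_def)
      ultimately show ?thesis by (simp add: D_def)
    qed
  qed auto
  then have "F 0 = G 0" by (simp add: D_def)
  then have "theta x = (\<Sum>\<^sub>\<infinity>k. c k)" by (simp add: F_def G_def theta_def f_def)
  also have "\<dots> = theta (1 / x) / sqrt x"
    unfolding c_def theta_def divide_inverse by (subst infsum_cmult_left') simp
  finally show ?thesis using x by (simp add: field_simps)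
qed

section \<open>Duplication identities for theta functions\<close>

text \<open>
  In Jacobi's notation with nome \<open>q = exp (- \<pi> x)\<close>, \<open>theta\<close> is \<open>\<theta>\<^sub>3\<close> and \<open>theta_alt\<close>
  is \<open>\<theta>\<^sub>4\<close>, both at argument zero.
\<close>

definition theta_alt :: "real \<Rightarrow> real" where
  "theta_alt x = (\<Sum>\<^sub>\<infinity>n::int. (if even n then 1 else - 1) * exp (- (pi * x * (of_int n)\<^sup>2)))"

lemma theta_has_sum:
  assumes "x > 0"
  shows "((\<lambda>n::int. exp (- (pi * x * (of_int n)\<^sup>2))) has_sum theta x) UNIV"
proof -
  have "(\<lambda>n::int. exp (- (pi * x * (of_int n)\<^sup>2))) summable_on UNIV"
    using summable_on_gauss[of "pi * x"] assms by simp
  then show ?thesis unfolding theta_def by (rule has_sum_infsum)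
qed

lemma theta_alt_has_sum:
  assumes "x > 0"
  shows "((\<lambda>n::int. (if even n then 1 else - 1) * exp (- (pi * x * (of_int n)\<^sup>2))) has_sum theta_alt x) UNIV"
  unfolding theta_alt_def
proof (rule has_sum_infsum, rule abs_summable_summable)
  have "(\<lambda>n::int. norm (exp (- (pi * x * (of_int n)\<^sup>2)))) summable_on UNIV"
    using summable_on_gauss[of "pi * x"] assms by simp
  then show "(\<lambda>n::int. norm ((if even n then 1 else - 1) * exp (- (pi * x * (of_int n)\<^sup>2)))) summable_on UNIV"
    by (rule summable_on_cong[THEN iffD1, rotated]) auto
qed

lemma has_sum_product_int:
  fixes f g :: "int \<Rightarrow> real"
  assumes f: "(f has_sum S) UNIV" and g: "(g has_sum T) UNIV"
  shows "((\<lambda>(m, n). f m * g n) has_sum (S * T)) UNIV"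
proof -
  note f' = summable_on_iff_abs_summable_on_real[THEN iffD1, OF has_sum_imp_summable[OF f]]
    and g' = summable_on_iff_abs_summable_on_real[THEN iffD1, OF has_sum_imp_summable[OF g]]
  have "(\<lambda>z. norm (case z of (m, n) \<Rightarrow> f m * g n)) summable_on Sigma UNIV (\<lambda>_. UNIV)"
    unfolding Infinite_Sum.abs_summable_on_Sigma_iff
  proof (intro conjI ballI)
    show "(\<lambda>n. norm (case (m, n) of (m, n) \<Rightarrow> f m * g n)) summable_on UNIV" for m
      using summable_on_cmult_right[OF g', of "norm (f m)"] by (simp add: abs_mult)
    have "(\<lambda>m. norm (f m) * (\<Sum>\<^sub>\<infinity>n. norm (g n))) summable_on UNIV"
      by (rule summable_on_cmult_left[OF f'])
    moreover have "norm (\<Sum>\<^sub>\<infinity>n. norm (case (m, n) of (m, n) \<Rightarrow> f m * g n)) = norm (f m) * (\<Sum>\<^sub>\<infinity>n. norm (g n))" for m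
    proof -
      have "(\<Sum>\<^sub>\<infinity>n. norm (case (m, n) of (m, n) \<Rightarrow> f m * g n)) = norm (f m) * (\<Sum>\<^sub>\<infinity>n. norm (g n))"
        unfolding prod.case norm_mult by (rule infsum_cmult_right')
      moreover have "norm (f m) * (\<Sum>\<^sub>\<infinity>n. norm (g n)) \<ge> 0" by (intro mult_nonneg_nonneg infsum_nonneg) auto
      ultimately show ?thesis by (simp only: real_norm_def abs_of_nonneg)
    qed
    ultimately show "(\<lambda>m. norm (\<Sum>\<^sub>\<infinity>n. norm (case (m, n) of (m, n) \<Rightarrow> f m * g n))) summable_on UNIV"
      by (simp only:)
  qed
  then have "(\<lambda>(m, n). f m * g n) summable_on Sigma UNIV (\<lambda>_. UNIV)"
    by (rule abs_summable_summable)
  then have "((\<lambda>(m, n). f m * g n) has_sum (S * T)) (Sigma UNIV (\<lambda>_. UNIV))"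
    by (intro has_sum_SigmaI[where g = "\<lambda>m. f m * T"])
       (auto intro!: has_sum_cmult_left f has_sum_cmult_right g)
  then show ?thesis by simp
qed

definition even_pairs :: "(int \<times> int) set" where "even_pairs = {(m, n). even (m + n)}"

lemma bij_even_pairs: "bij_betw (\<lambda>(a, b). (a + b, a - b)) UNIV even_pairs"
proof (rule bij_betwI[where g = "\<lambda>(m, n). ((m + n) div 2, (m - n) div 2)"])
  show "(\<lambda>(m, n). ((m + n) div 2, (m - n) div 2)) \<in> even_pairs \<rightarrow> UNIV" by auto
  show "(\<lambda>(a, b). (a + b, a - b)) \<in> UNIV \<rightarrow> even_pairs" by (auto simp: even_pairs_def)
  fix y assume "y \<in> even_pairs"
  then obtain m n k where y: "y = (m, n)" "m + n = 2 * k" by (auto simp: even_pairs_def dvd_def)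
  have "m - n = 2 * (k - n)" using y by simp
  then have "(m + n) div 2 = k" "(m - n) div 2 = k - n" using y(2) by (metis nonzero_mult_div_cancel_left zero_neq_numeral)+
  with y show "(case case y of (m, n) \<Rightarrow> ((m + n) div 2, (m - n) div 2) of (a, b) \<Rightarrow> (a + b, a - b)) = y"
    by simp
qed auto

text \<open>
  Products of two theta values are sums over \<open>\<int> \<times> \<int>\<close>. Split by the parity of \<open>m + n\<close>: on the even
  sublattice \<open>m = a + b\<close>, \<open>n = a - b\<close> gives \<open>m\<^sup>2 + n\<^sup>2 = 2 (a\<^sup>2 + b\<^sup>2)\<close>, that is, the doubled
  argument; the odd part cancels, by opposite signs in the first identity and by the symmetry
  \<open>(m, n) \<mapsto> (n, m)\<close> in the second. The two identities say that \<open>theta\<^sup>2\<close> and \<open>theta_alt\<^sup>2\<close>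
  perform a step of the arithmetic-geometric mean when \<open>x\<close> is doubled.
\<close>

lemma theta_square_split:
  assumes x: "x > 0"
  shows "(theta x)\<^sup>2 + (theta_alt x)\<^sup>2 = 2 * (theta (2 * x))\<^sup>2"
    and "theta x * theta_alt x = (theta_alt (2 * x))\<^sup>2"
proof -
  define e where "e n = exp (- (pi * x * (of_int n)\<^sup>2))" for n :: int
  define \<sigma> where "\<sigma> n = (if even n then 1 else - 1 :: real)" for n :: int
  have e2: "e (a + b) * e (a - b) = exp (- (pi * (2 * x) * (of_int a)\<^sup>2)) * exp (- (pi * (2 * x) * (of_int b)\<^sup>2))" for a b
    by (simp add: e_def power2_eq_square algebra_simps flip: exp_add)
  have \<sigma>2: "\<sigma> (a - b) = \<sigma> a * \<sigma> b" for a b by (simp add: \<sigma>_def)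
  note th = theta_has_sum[OF x, folded e_def] and al = theta_alt_has_sum[OF x, folded e_def \<sigma>_def]
  have UN: "(UNIV :: (int \<times> int) set) = even_pairs \<union> - even_pairs" by auto
  have split: "(f has_sum (infsum f even_pairs + infsum f (- even_pairs))) UNIV"
    if "(f has_sum S) UNIV" for f :: "int \<times> int \<Rightarrow> real" and S
    unfolding UN
    by (intro has_sum_Un_disjoint has_sum_infsum summable_on_subset_banach[OF has_sum_imp_summable[OF that]]) auto
  \<comment> \<open>the even and the odd part of the square of \<open>theta\<close>\<close>
  define p where "p = infsum (\<lambda>(m, n). e m * e n) even_pairs"
  define q where "q = infsum (\<lambda>(m, n). e m * e n) (- even_pairs)"
  have "((\<lambda>(m, n). e m * e n) has_sum (theta x * theta x)) UNIV"
    by (rule has_sum_product_int[OF th th])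
  from has_sum_unique[OF this split[OF this]] have 1: "theta x * theta x = p + q"
    by (simp add: p_def q_def)
  have "((\<lambda>(m, n). (\<sigma> m * e m) * (\<sigma> n * e n)) has_sum (theta_alt x * theta_alt x)) UNIV"
    by (rule has_sum_product_int[OF al al])
  from has_sum_unique[OF this split[OF this]]
  have "theta_alt x * theta_alt x = infsum (\<lambda>(m, n). (\<sigma> m * e m) * (\<sigma> n * e n)) even_pairs +
        infsum (\<lambda>(m, n). (\<sigma> m * e m) * (\<sigma> n * e n)) (- even_pairs)" .
  also have "infsum (\<lambda>(m, n). (\<sigma> m * e m) * (\<sigma> n * e n)) even_pairs = p"
    unfolding p_def
  proof (intro infsum_cong, clarify)
    fix m n assume "(m, n) \<in> even_pairs"
    then have "\<sigma> m * \<sigma> n = 1" by (auto simp: even_pairs_def \<sigma>_def)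
    then show "(\<sigma> m * e m) * (\<sigma> n * e n) = e m * e n" by algebra
  qed
  also have "infsum (\<lambda>(m, n). (\<sigma> m * e m) * (\<sigma> n * e n)) (- even_pairs) = infsum (\<lambda>z. - (case z of (m, n) \<Rightarrow> e m * e n)) (- even_pairs)"
  proof (intro infsum_cong, clarify)
    fix m n assume "(m, n) \<notin> even_pairs"
    then have "\<sigma> m * \<sigma> n = - 1" by (auto simp: even_pairs_def \<sigma>_def)
    then show "(\<sigma> m * e m) * (\<sigma> n * e n) = - (e m * e n)" by algebra
  qed
  also have "\<dots> = - q" unfolding q_def by (rule infsum_uminus)
  finally have 2: "theta_alt x * theta_alt x = p - q" by simp
  have "p = infsum (\<lambda>(a, b). e (a + b) * e (a - b)) UNIV"
    unfolding p_def infsum_reindex_bij_betw[OF bij_even_pairs, symmetric] by (simp add: case_prod_unfold)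
  also have "\<dots> = theta (2 * x) * theta (2 * x)"
    unfolding e2 using x by (intro infsumI has_sum_product_int theta_has_sum) auto
  finally have p: "p = theta (2 * x) * theta (2 * x)" .
  show "(theta x)\<^sup>2 + (theta_alt x)\<^sup>2 = 2 * (theta (2 * x))\<^sup>2"
    using 1 2 p by (simp add: power2_eq_square)
  have "((\<lambda>(m, n). e m * (\<sigma> n * e n)) has_sum (theta x * theta_alt x)) UNIV"
    by (rule has_sum_product_int[OF th al])
  from has_sum_unique[OF this split[OF this]]
  have "theta x * theta_alt x = infsum (\<lambda>(m, n). e m * (\<sigma> n * e n)) even_pairs +
        infsum (\<lambda>(m, n). e m * (\<sigma> n * e n)) (- even_pairs)" .
  also have "infsum (\<lambda>(m, n). e m * (\<sigma> n * e n)) (- even_pairs) = 0"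
  proof -
    have "bij_betw prod.swap (- even_pairs) (- even_pairs)"
      by (rule bij_betwI[where g = prod.swap]) (auto simp: even_pairs_def add.commute)
    from infsum_reindex_bij_betw[OF this, of "\<lambda>(m, n). e m * (\<sigma> n * e n)"]
    have "infsum (\<lambda>(m, n). e m * (\<sigma> n * e n)) (- even_pairs) = infsum (\<lambda>(m, n). e n * (\<sigma> m * e m)) (- even_pairs)"
      by (simp add: case_prod_unfold)
    also have "\<dots> = infsum (\<lambda>z. - (case z of (m, n) \<Rightarrow> e m * (\<sigma> n * e n))) (- even_pairs)"
    proof (intro infsum_cong, clarify)
      fix m n assume "(m, n) \<notin> even_pairs"
      then have "\<sigma> m = - \<sigma> n" by (auto simp: even_pairs_def \<sigma>_def)
      then show "e n * (\<sigma> m * e m) = - (e m * (\<sigma> n * e n))" by simp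
    qed
    also have "\<dots> = - infsum (\<lambda>(m, n). e m * (\<sigma> n * e n)) (- even_pairs)" by (rule infsum_uminus)
    finally show ?thesis by simp
  qed
  also have "infsum (\<lambda>(m, n). e m * (\<sigma> n * e n)) even_pairs = infsum (\<lambda>(a, b). \<sigma> (a - b) * (e (a + b) * e (a - b))) UNIV"
    unfolding infsum_reindex_bij_betw[OF bij_even_pairs, symmetric] by (simp add: case_prod_unfold mult_ac)
  also have "\<dots> = infsum (\<lambda>(a, b). (\<sigma> a * exp (- (pi * (2 * x) * (of_int a)\<^sup>2))) * (\<sigma> b * exp (- (pi * (2 * x) * (of_int b)\<^sup>2)))) UNIV"
    unfolding e2 \<sigma>2 by (simp only: mult_ac)
  also have "\<dots> = theta_alt (2 * x) * theta_alt (2 * x)"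
    unfolding \<sigma>_def using x by (intro infsumI has_sum_product_int theta_alt_has_sum) auto
  finally show "theta x * theta_alt x = (theta_alt (2 * x))\<^sup>2"
    by (simp add: power2_eq_square)
qed

text \<open>
  The even-indexed terms of \<open>theta x\<close> form \<open>theta (4 * x)\<close>. This lets the functional equation of
  \<open>theta\<close> speak about \<open>theta_alt\<close> as well.
\<close>

lemma theta_alt_eq:
  assumes x: "x > 0"
  shows "theta_alt x = 2 * theta (4 * x) - theta x"
proof -
  define e where "e n = exp (- (pi * x * (of_int n)\<^sup>2))" for n :: int
  define \<sigma> where "\<sigma> n = (if even n then 1 else - 1 :: real)" for n :: int
  have bij: "bij_betw (\<lambda>n::int. 2 * n) UNIV {n. even n}"
    by (rule bij_betwI[where g = "\<lambda>n. n div 2"]) auto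
  have "((\<lambda>n::int. e n + \<sigma> n * e n) has_sum (theta x + theta_alt x)) UNIV"
    unfolding e_def \<sigma>_def by (intro has_sum_add theta_has_sum theta_alt_has_sum x)
  moreover have "((\<lambda>n::int. 2 * e (2 * n)) has_sum (2 * theta (4 * x))) UNIV"
    using has_sum_cmult_right[OF theta_has_sum[of "4 * x"], of 2] x
    by (simp add: e_def power_mult_distrib mult_ac)
  then have "((\<lambda>n::int. 2 * e n) has_sum (2 * theta (4 * x))) {n. even n}"
    by (subst (asm) has_sum_reindex_bij_betw[OF bij])
  then have "((\<lambda>n::int. e n + \<sigma> n * e n) has_sum (2 * theta (4 * x))) UNIV"
    by (rule has_sum_cong_neutral[THEN iffD1, rotated -1]) (auto simp: \<sigma>_def)
  ultimately show ?thesis using has_sum_unique by fastforce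
qed

lemma theta_ge_1:
  assumes x: "x > 0"
  shows "theta x \<ge> 1"
proof -
  have "((\<lambda>n::int. if n = 0 then 1 else 0) has_sum (1::real)) UNIV"
    by (rule has_sum_finite_neutralI[of "{0}"]) auto
  then show ?thesis using theta_has_sum[OF x] by (rule has_sum_mono) auto
qed

lemma theta_minus_1_le:
  assumes x: "x \<ge> 1"
  shows "theta x - 1 \<le> exp (- (pi * (x - 1))) * (theta 1 - 1)"
proof -
  have d: "((\<lambda>n::int. if n = 0 then 1 else 0) has_sum (1::real)) UNIV"
    by (rule has_sum_finite_neutralI[of "{0}"]) auto
  have d': "((\<lambda>n::int. - (if n = 0 then 1 else 0)) has_sum (- 1::real)) UNIV"
    unfolding has_sum_uminus using d by simp
  have 1: "((\<lambda>n::int. exp (- (pi * y * (of_int n)\<^sup>2)) - (if n = 0 then 1 else 0)) has_sum (theta y - 1)) UNIV" if "y > 0" for y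
    using has_sum_add[OF theta_has_sum[OF that] d'] by simp
  have g1: "((\<lambda>n::int. exp (- (pi * (x - 1))) * (exp (- (pi * 1 * (of_int n)\<^sup>2)) - (if n = 0 then 1 else 0))) has_sum
      (exp (- (pi * (x - 1))) * (theta 1 - 1))) UNIV"
    by (intro has_sum_cmult_right 1) auto
  have f1: "((\<lambda>n::int. exp (- (pi * x * (of_int n)\<^sup>2)) - (if n = 0 then 1 else 0)) has_sum (theta x - 1)) UNIV"
    using x by (intro 1) auto
  show ?thesis
  proof (rule has_sum_mono[OF f1 g1])
    fix n :: int
    show "exp (- (pi * x * (of_int n)\<^sup>2)) - (if n = 0 then 1 else 0) \<le>
      exp (- (pi * (x - 1))) * (exp (- (pi * 1 * (of_int n)\<^sup>2)) - (if n = 0 then 1 else 0))"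
    proof (cases "n = 0")
      case False
      then have "1 \<le> \<bar>n\<bar>" by simp
      then have "1 \<le> n\<^sup>2" using one_le_power[of "\<bar>n\<bar>" 2] by simp
      then have "1 \<le> (real_of_int n)\<^sup>2" by (simp flip: of_int_power)
      then have "pi * (x - 1) * 1 \<le> pi * (x - 1) * (real_of_int n)\<^sup>2" using x by (intro mult_left_mono) auto
      then show ?thesis using False by (simp add: algebra_simps flip: exp_add)
    qed auto
  qed
qed

lemma theta_tendsto_1: "(\<lambda>k. theta (2 ^ k)) \<longlonglongrightarrow> 1"
proof (rule tendsto_sandwich)
  show "\<forall>\<^sub>F k in sequentially. 1 \<le> theta (2 ^ k)" by (intro always_eventually allI theta_ge_1) auto
  show "\<forall>\<^sub>F k in sequentially. theta (2 ^ k) \<le> 1 + exp (- (pi * (2 ^ k - 1))) * (theta 1 - 1)"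
    using theta_minus_1_le[of "2 ^ _"] by (intro always_eventually allI) (smt (verit) one_le_power)
  have "(\<lambda>k. 1 + exp (- (pi * (2 ^ k - 1))) * (theta 1 - 1)) \<longlonglongrightarrow> 1 + 0 * (theta 1 - 1)"
    by (intro tendsto_intros) real_asymp
  then show "(\<lambda>k. 1 + exp (- (pi * (2 ^ k - 1))) * (theta 1 - 1)) \<longlonglongrightarrow> 1" by simp
qed auto

text \<open>
  The modulus at the lemniscatic point is \<open>1 / sqrt 2\<close>. The functional equation expresses the values
  of \<open>theta\<close> and \<open>theta_alt\<close> at \<open>1 / 4\<close>, \<open>1 / 2\<close> and \<open>1\<close> through \<open>a = theta 1\<close> and
  \<open>h = theta 4\<close>, and two duplication steps from \<open>1 / 4\<close> to \<open>1\<close> give a polynomial relation between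
  \<open>a\<close> and \<open>h\<close> which is exactly the claim.
\<close>

lemma theta_alt_at_1: "2 * theta_alt 1 ^ 4 = theta 1 ^ 4"
proof -
  define a h where "a = theta 1" and "h = theta 4"
  have q: "theta (1 / 4) = 2 * h" using theta_functional_equation[of 4] by (simp add: h_def)
  have b1: "theta_alt 1 = 2 * h - a" using theta_alt_eq[of 1] by (simp add: a_def h_def)
  have b4: "theta_alt (1 / 4) = 2 * (a - h)" using theta_alt_eq[of "1 / 4"] q by (simp add: a_def)
  have "(theta (1 / 2))\<^sup>2 = 2 * (theta 2)\<^sup>2"
    using theta_functional_equation[of 2] by (simp add: power_mult_distrib)
  also have "\<dots> = a\<^sup>2 + (2 * h - a)\<^sup>2" using theta_square_split(1)[of 1] b1 by (simp add: a_def)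
  finally have t2: "(theta (1 / 2))\<^sup>2 = a\<^sup>2 + (2 * h - a)\<^sup>2" .
  have "theta_alt 1 ^ 4 = ((theta_alt 1)\<^sup>2)\<^sup>2" by simp
  also have "\<dots> = (theta (1 / 2) * theta_alt (1 / 2))\<^sup>2" using theta_square_split(2)[of "1 / 2"] by simp
  also have "\<dots> = (theta (1 / 2))\<^sup>2 * (theta_alt (1 / 2))\<^sup>2" by (simp add: power_mult_distrib)
  also have "(theta_alt (1 / 2))\<^sup>2 = theta (1 / 4) * theta_alt (1 / 4)" using theta_square_split(2)[of "1 / 4"] by simp
  finally have "theta_alt 1 ^ 4 = (a\<^sup>2 + (2 * h - a)\<^sup>2) * (2 * h * (2 * (a - h)))"
    by (simp add: t2 q b4)
  then have "(2 * h - a) ^ 4 = (a\<^sup>2 + (2 * h - a)\<^sup>2) * (2 * h * (2 * (a - h)))" by (simp add: b1)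
  then have "2 * (2 * h - a) ^ 4 = a ^ 4" by algebra
  then show ?thesis by (simp add: b1 a_def)
qed

section \<open>The arithmetic-geometric mean and a lemniscatic integral\<close>

text \<open>
  Gauss's complete elliptic integral, written over the whole real line; it equals
  \<open>\<pi> / agm a b\<close> where \<open>agm\<close> is the arithmetic-geometric mean.
\<close>

definition agm_integral :: "real \<Rightarrow> real \<Rightarrow> real" where
  "agm_integral a b = (LBINT t. 1 / sqrt ((t\<^sup>2 + a\<^sup>2) * (t\<^sup>2 + b\<^sup>2)))"

lemma einterval_UNIV: "einterval (-\<infinity>) \<infinity> = UNIV"
  by (auto simp: einterval_def)

lemma einterval_0_infinity: "einterval 0 \<infinity> = {0<..}"
  by (auto simp: einterval_def)

lemma lorentzian:
  assumes m: "(m::real) > 0"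
  shows "integrable lborel (\<lambda>t. 1 / (t\<^sup>2 + m\<^sup>2))" and "(LBINT t. 1 / (t\<^sup>2 + m\<^sup>2)) = pi / m"
proof -
  have d: "((\<lambda>t. arctan (t / m) / m) has_real_derivative 1 / (t\<^sup>2 + m\<^sup>2)) (at t)" for t
  proof -
    have e: "1 + (t / m)\<^sup>2 = (t\<^sup>2 + m\<^sup>2) / m\<^sup>2" using m by (simp add: field_simps)
    have "((\<lambda>t. arctan (t / m) / m) has_real_derivative inverse (1 + (t / m)\<^sup>2) * (1 / m) / m) (at t)"
      using m by (auto intro!: derivative_eq_intros)
    also have "inverse (1 + (t / m)\<^sup>2) * (1 / m) / m = 1 / (t\<^sup>2 + m\<^sup>2)"
      unfolding e using m by (simp add: power2_eq_square)
    finally show ?thesis .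
  qed
  have "((\<lambda>t. arctan (t / m) / m) \<longlongrightarrow> - (pi / 2) / m) at_bot"
    by (intro tendsto_divide tendsto_const filterlim_compose[OF tendsto_arctan_at_bot])
       (use m in \<open>real_asymp, simp\<close>)
  then have A: "(((\<lambda>t. arctan (t / m) / m) \<circ> real_of_ereal) \<longlongrightarrow> - (pi / 2) / m) (at_right (-\<infinity>))"
    by (simp only: ereal_tendsto_simps)
  have "((\<lambda>t. arctan (t / m) / m) \<longlongrightarrow> (pi / 2) / m) at_top"
    by (intro tendsto_divide tendsto_const filterlim_compose[OF tendsto_arctan_at_top])
       (use m in \<open>real_asymp, simp\<close>)
  then have B: "(((\<lambda>t. arctan (t / m) / m) \<circ> real_of_ereal) \<longlongrightarrow> (pi / 2) / m) (at_left \<infinity>)"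
    by (simp only: ereal_tendsto_simps)
  have p: "t\<^sup>2 + m\<^sup>2 \<noteq> 0" for t using m by (simp add: add_nonneg_eq_0_iff)
  have c: "isCont (\<lambda>t. 1 / (t\<^sup>2 + m\<^sup>2)) t" for t using p by (intro continuous_intros) auto
  note * = interval_integral_FTC_nonneg[of "-\<infinity>" \<infinity> "\<lambda>t. arctan (t / m) / m" "\<lambda>t. 1 / (t\<^sup>2 + m\<^sup>2)", OF _ d c _ A B]
  show "integrable lborel (\<lambda>t. 1 / (t\<^sup>2 + m\<^sup>2))"
    using *(1) by (simp add: einterval_UNIV set_integrable_def)
  show "(LBINT t. 1 / (t\<^sup>2 + m\<^sup>2)) = pi / m"
    using *(2) by (simp add: einterval_UNIV interval_lebesgue_integral_def set_lebesgue_integral_def field_simps)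
qed

lemma agm_integral_bounds:
  assumes "0 < m" "m \<le> a" "m \<le> b" "a \<le> M" "b \<le> (M::real)"
  shows "integrable lborel (\<lambda>t. 1 / sqrt ((t\<^sup>2 + a\<^sup>2) * (t\<^sup>2 + b\<^sup>2)))"
    and "pi / M \<le> agm_integral a b" and "agm_integral a b \<le> pi / m"
proof -
  have pos: "0 < t\<^sup>2 + c\<^sup>2" if "c > 0" for c t :: real using that by (simp add: add_nonneg_pos)
  have le: "(t\<^sup>2 + c\<^sup>2)\<^sup>2 \<le> (t\<^sup>2 + a\<^sup>2) * (t\<^sup>2 + b\<^sup>2)" if "0 < c" "c \<le> a" "c \<le> b" for t c
    unfolding power2_eq_square[of "t\<^sup>2 + c\<^sup>2"] using that by (intro mult_mono add_left_mono power_mono) auto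
  have S: "0 < (t\<^sup>2 + a\<^sup>2) * (t\<^sup>2 + b\<^sup>2)" for t
    using assms by (intro mult_pos_pos pos) auto
  have up: "1 / sqrt ((t\<^sup>2 + a\<^sup>2) * (t\<^sup>2 + b\<^sup>2)) \<le> 1 / (t\<^sup>2 + m\<^sup>2)" for t
    using real_le_rsqrt[OF le[of m t]] assms pos[of m t] S[of t]
    by (intro divide_left_mono mult_pos_pos[of "sqrt _"]) auto
  have ge: "(t\<^sup>2 + a\<^sup>2) * (t\<^sup>2 + b\<^sup>2) \<le> (t\<^sup>2 + M\<^sup>2)\<^sup>2" for t
    unfolding power2_eq_square[of "t\<^sup>2 + M\<^sup>2"] using assms by (intro mult_mono add_left_mono power_mono) auto
  have lo: "1 / (t\<^sup>2 + M\<^sup>2) \<le> 1 / sqrt ((t\<^sup>2 + a\<^sup>2) * (t\<^sup>2 + b\<^sup>2))" for t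
    using real_le_lsqrt[OF _ ge[of t]] assms pos[of M t] S[of t]
    by (intro divide_left_mono mult_pos_pos[of _ "sqrt _"]) auto
  show i: "integrable lborel (\<lambda>t. 1 / sqrt ((t\<^sup>2 + a\<^sup>2) * (t\<^sup>2 + b\<^sup>2)))"
    using lorentzian(1)[OF assms(1)]
  proof (rule Bochner_Integration.integrable_bound)
    show "AE t in lborel. norm (1 / sqrt ((t\<^sup>2 + a\<^sup>2) * (t\<^sup>2 + b\<^sup>2))) \<le> norm (1 / (t\<^sup>2 + m\<^sup>2))"
      using up by (intro AE_I2) (auto simp: abs_le_iff)
  qed measurable
  have M: "M > 0" using assms by simp
  show "pi / M \<le> agm_integral a b"
    unfolding agm_integral_def lorentzian(2)[OF M, symmetric]
    by (intro integral_mono lorentzian(1) i lo M)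
  show "agm_integral a b \<le> pi / m"
    unfolding agm_integral_def lorentzian(2)[OF assms(1), symmetric]
    by (intro integral_mono lorentzian(1) i up assms)
qed

lemma agm_integral_half:
  assumes "a > 0" "b > 0"
  shows "set_integrable lborel {0<..} (\<lambda>t. 1 / sqrt ((t\<^sup>2 + a\<^sup>2) * (t\<^sup>2 + b\<^sup>2)))"
    and "agm_integral a b = 2 * (LBINT t:{0<..}. 1 / sqrt ((t\<^sup>2 + a\<^sup>2) * (t\<^sup>2 + b\<^sup>2)))"
proof -
  let ?f = "\<lambda>t. 1 / sqrt ((t\<^sup>2 + a\<^sup>2) * (t\<^sup>2 + b\<^sup>2))"
  have i: "integrable lborel ?f"
    by (rule agm_integral_bounds(1)[of "min a b" _ _ "max a b"]) (use assms in auto)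
  have s: "set_integrable lborel A ?f" if "A \<in> sets borel" for A
    using that i unfolding set_integrable_def by (intro integrable_mult_indicator) auto
  show "set_integrable lborel {0<..} ?f" by (rule s) auto
  have "has_bochner_integral lborel (\<lambda>t. indicator {0..} t *\<^sub>R ?f t) (LBINT t:{0..}. ?f t)"
    using s[of "{0..}"] by (auto simp: has_bochner_integral_iff set_lebesgue_integral_def set_integrable_def)
  from has_bochner_integral_even_function[OF this]
  have "agm_integral a b = 2 * (LBINT t:{0..}. ?f t)"
    by (simp add: agm_integral_def has_bochner_integral_iff)
  also have "(LBINT t:{0..}. ?f t) = (LBINT t:{0<..}. ?f t)"
    unfolding set_lebesgue_integral_def
  proof (rule integral_cong_AE)
    show "AE t in lborel. indicator {0..} t *\<^sub>R ?f t = indicator {0<..} t *\<^sub>R ?f t"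
      using AE_lborel_singleton[of "0::real"] by eventually_elim (auto simp: indicator_def)
  qed measurable
  finally show "agm_integral a b = 2 * (LBINT t:{0<..}. ?f t)" .
qed

text \<open>
  Gauss's invariance, through the substitution \<open>u = (t - a b / t) / 2\<close>, which maps \<open>(0, \<infinity>)\<close>
  increasingly onto the real line and turns \<open>u\<^sup>2 + a b\<close> into a perfect square.
\<close>

lemma agm_integral_step:
  assumes a: "a > 0" and b: "b > 0"
  shows "agm_integral ((a + b) / 2) (sqrt (a * b)) = agm_integral a b"
proof -
  let ?A = "(a + b) / 2" and ?G = "sqrt (a * b)"
  define f where "f u = 1 / sqrt ((u\<^sup>2 + ?A\<^sup>2) * (u\<^sup>2 + ?G\<^sup>2))" for u
  define F where "F t = 1 / sqrt ((t\<^sup>2 + a\<^sup>2) * (t\<^sup>2 + b\<^sup>2))" for t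
  define g where "g t = (t - a * b / t) / 2" for t
  define g' where "g' t = (1 + a * b / t\<^sup>2) / 2" for t
  have A0: "?A > 0" and G0: "?G > 0" using a b by auto
  have pos: "0 < t\<^sup>2 + c\<^sup>2" if "c > 0" for c t :: real using that by (simp add: add_nonneg_pos)
  have key: "f (g t) * g' t = 2 * F t" if t: "t > 0" for t
  proof -
    have e1: "(g t)\<^sup>2 + ?G\<^sup>2 = ((t + a * b / t) / 2)\<^sup>2"
      using a b t by (simp add: g_def power2_eq_square field_simps)
    have e2: "(g t)\<^sup>2 + ?A\<^sup>2 = (t\<^sup>2 + a\<^sup>2) * (t\<^sup>2 + b\<^sup>2) / (2 * t)\<^sup>2"
      using t by (simp add: g_def power2_eq_square field_simps)
    define S r where "S = sqrt ((t\<^sup>2 + a\<^sup>2) * (t\<^sup>2 + b\<^sup>2))" and "r = t + a * b / t"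
    have S: "S > 0" "S\<^sup>2 = (t\<^sup>2 + a\<^sup>2) * (t\<^sup>2 + b\<^sup>2)"
      using pos[OF a, of t] pos[OF b, of t] by (simp_all add: S_def)
    have r: "r > 0" using a b t by (simp add: r_def add_pos_pos)
    have e2': "(g t)\<^sup>2 + ?A\<^sup>2 = (S / (2 * t))\<^sup>2"
      unfolding power_divide[of S] S(2) by (rule e2)
    have "((g t)\<^sup>2 + ?A\<^sup>2) * ((g t)\<^sup>2 + ?G\<^sup>2) = (S / (2 * t) * (r / 2))\<^sup>2"
      by (simp only: e1 e2' r_def power_mult_distrib)
    then have f: "f (g t) = 1 / (S / (2 * t) * (r / 2))"
      using S(1) r t by (simp only: f_def real_sqrt_abs) simp
    have g': "g' t = r / (2 * t)"
      using t by (simp add: g'_def r_def power2_eq_square field_simps)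
    have F: "F t = 1 / S" by (simp add: F_def S_def)
    show ?thesis unfolding f g' F using S(1) r t by (simp add: field_simps)
  qed
  have intF: "set_integrable lborel {0<..} F" and valF: "agm_integral a b = 2 * (LBINT t:{0<..}. F t)"
    unfolding F_def by (rule agm_integral_half[OF a b])+
  have i2: "set_integrable lborel {0<..} (\<lambda>t. 2 * F t)"
    using intF by (intro set_integrable_mult_right)
  have l0: "filterlim g at_bot (at_right 0)" unfolding g_def using a b by real_asymp
  have l1: "filterlim g at_top at_top" unfolding g_def using a b by real_asymp
  have tl0: "((ereal \<circ> g \<circ> real_of_ereal) \<longlongrightarrow> -\<infinity>) (at_right 0)"
    unfolding zero_ereal_def using l0 by (simp only: ereal_tendsto_simps)
  have tl1: "((ereal \<circ> g \<circ> real_of_ereal) \<longlongrightarrow> \<infinity>) (at_left \<infinity>)"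
    using l1 by (simp only: ereal_tendsto_simps)
  have "(LBINT u=-\<infinity>..\<infinity>. f u) = (LBINT t=0..\<infinity>. f (g t) * g' t)"
  proof (rule interval_integral_substitution_nonneg(2)[OF _ _ _ _ _ _ tl0 tl1])
    fix t :: real assume t: "0 < ereal t"
    then have "t > 0" by simp
    then show "DERIV g t :> g' t"
      unfolding g_def g'_def by (auto intro!: derivative_eq_intros simp: power2_eq_square field_simps)
    show "isCont f (g t)" unfolding f_def
      using pos[OF A0, of "g t"] pos[OF G0, of "g t"] by (intro continuous_intros) auto
    show "isCont g' t" unfolding g'_def using \<open>t > 0\<close> by (intro continuous_intros) auto
    show "0 \<le> f (g t)" by (simp add: f_def)
  next
    fix t :: real
    show "0 \<le> g' t" using a b by (simp add: g'_def)
  next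
    show "set_integrable lborel (einterval 0 \<infinity>) (\<lambda>t. f (g t) * g' t)"
      unfolding einterval_0_infinity using i2
      by (rule set_integrable_cong[THEN iffD1, rotated -1]) (auto simp: key)
  qed simp
  also have "\<dots> = (LBINT t:{0<..}. f (g t) * g' t)"
    by (simp add: interval_lebesgue_integral_def einterval_0_infinity)
  also have "\<dots> = (LBINT t:{0<..}. 2 * F t)"
    by (intro set_lebesgue_integral_cong) (auto simp: key)
  also have "\<dots> = agm_integral a b" unfolding valF by simp
  also have "(LBINT u=-\<infinity>..\<infinity>. f u) = agm_integral ?A ?G"
    by (simp add: agm_integral_def interval_lebesgue_integral_def einterval_UNIV
        set_lebesgue_integral_def f_def)
  finally show ?thesis .
qed

lemma agm_integral_scale:
  assumes c: "c > 0"
  shows "agm_integral (c * a) (c * b) = agm_integral a b / c"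
proof -
  have "agm_integral (c * a) (c * b) = \<bar>c\<bar> *\<^sub>R (LBINT t. 1 / sqrt (((0 + c * t)\<^sup>2 + (c * a)\<^sup>2) * ((0 + c * t)\<^sup>2 + (c * b)\<^sup>2)))"
    unfolding agm_integral_def using c by (intro lborel_integral_real_affine) auto
  also have "(\<lambda>t. 1 / sqrt (((0 + c * t)\<^sup>2 + (c * a)\<^sup>2) * ((0 + c * t)\<^sup>2 + (c * b)\<^sup>2))) =
     (\<lambda>t. 1 / c\<^sup>2 * (1 / sqrt ((t\<^sup>2 + a\<^sup>2) * (t\<^sup>2 + b\<^sup>2))))"
  proof
    fix t
    have "((0 + c * t)\<^sup>2 + (c * a)\<^sup>2) * ((0 + c * t)\<^sup>2 + (c * b)\<^sup>2) = (c\<^sup>2)\<^sup>2 * ((t\<^sup>2 + a\<^sup>2) * (t\<^sup>2 + b\<^sup>2))"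
      by (simp add: algebra_simps power2_eq_square)
    then show "1 / sqrt (((0 + c * t)\<^sup>2 + (c * a)\<^sup>2) * ((0 + c * t)\<^sup>2 + (c * b)\<^sup>2)) = 1 / c\<^sup>2 * (1 / sqrt ((t\<^sup>2 + a\<^sup>2) * (t\<^sup>2 + b\<^sup>2)))"
      by (simp only: real_sqrt_mult real_sqrt_abs) simp
  qed
  also have "\<bar>c\<bar> *\<^sub>R (LBINT t. 1 / c\<^sup>2 * (1 / sqrt ((t\<^sup>2 + a\<^sup>2) * (t\<^sup>2 + b\<^sup>2)))) = c * (1 / c\<^sup>2 * agm_integral a b)"
    unfolding agm_integral_def integral_mult_right_zero using c by simp
  also have "\<dots> = agm_integral a b / c" using c by (simp add: power2_eq_square)
  finally show ?thesis .
qed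

text \<open>
  The substitution \<open>y = 1 / (1 + t\<^sup>2)\<^sup>2\<close> leads to Euler's Beta integral. Its inverse is taken with the
  negative sign, \<open>t = - sqrt (1 / sqrt y - 1)\<close>, so that it is increasing from \<open>(0, 1)\<close> onto
  \<open>(-\<infinity>, 0)\<close>; the integrand is even.
\<close>

lemma agm_integral_lemniscate: "agm_integral (sqrt 2) 1 = Beta (1 / 4) (1 / 2) / 2"
proof -
  define f where "f t = 1 / sqrt ((t\<^sup>2 + (sqrt 2)\<^sup>2) * (t\<^sup>2 + 1\<^sup>2))" for t :: real
  define g where "g y = - sqrt (1 / sqrt y - 1)" for y :: real
  define g' where "g' y = 1 / (4 * y * sqrt y * sqrt (1 / sqrt y - 1))" for y :: real
  define h where "h y = y powr (1 / 4 - 1) * (1 - y) powr (1 / 2 - 1)" for y :: real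
  have r: "1 / sqrt y - 1 > 0" if "0 < y" "y < 1" for y :: real using that by (simp add: field_simps)
  have key: "f (g y) * g' y = 1 / 4 * h y" if y: "0 < y" "y < 1" for y
  proof -
    \<comment> \<open>in terms of the fourth root of \<open>y\<close> everything is rational up to \<open>sqrt (1 \<plusminus> u\<^sup>2)\<close>\<close>
    define u where "u = y powr (1 / 4)"
    have u: "u > 0" "u ^ 4 = y" "u\<^sup>2 = sqrt y" using y 
      by (simp_all add: u_def powr_power powr_half_sqrt)
    have u1: "1 - u\<^sup>2 > 0" using r[OF y] y by (simp add: u(3))
    define P Q where "P = sqrt (1 + u\<^sup>2)" and "Q = sqrt (1 - u\<^sup>2)"
    have PQ: "P > 0" "Q > 0" "sqrt (1 - y) = Q * P"
      using u1 by (auto simp: P_def Q_def add_pos_nonneg algebra_simps simp flip: u(2) real_sqrt_mult power_add power2_eq_square)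
    have s: "1 / sqrt y - 1 = (1 - u\<^sup>2) / u\<^sup>2"
      using u(1) by (simp add: diff_divide_distrib flip: u(3))
    have S: "sqrt (1 / sqrt y - 1) = Q / u"
      unfolding s Q_def using u(1) by (simp add: real_sqrt_divide)
    have "(g y)\<^sup>2 = (1 - u\<^sup>2) / u\<^sup>2"
      using r[OF y] by (simp add: g_def flip: s)
    then have "(g y)\<^sup>2 + (sqrt 2)\<^sup>2 = (1 + u\<^sup>2) / u\<^sup>2" "(g y)\<^sup>2 + 1\<^sup>2 = 1 / u\<^sup>2"
      using u(1) by (simp_all add: diff_divide_distrib add_divide_distrib)
    then have "((g y)\<^sup>2 + (sqrt 2)\<^sup>2) * ((g y)\<^sup>2 + 1\<^sup>2) = (1 + u\<^sup>2) / (u\<^sup>2)\<^sup>2"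
      by (simp add: power2_eq_square)
    then have F: "f (g y) = u\<^sup>2 / P"
      unfolding f_def P_def by (simp only: real_sqrt_divide real_sqrt_abs abs_power2) simp
    have G: "g' y = 1 / (4 * u ^ 4 * u\<^sup>2 * (Q / u))"
      by (simp add: g'_def S u)
    have "y powr (1 / 4 - 1) = u / u ^ 4"
      unfolding powr_diff u_def[symmetric] u(2) using y by simp
    moreover have "(1 - y) powr (1 / 2 - 1) = 1 / (Q * P)"
    proof -
      have "1 - y = (sqrt (1 - y))\<^sup>2" using y by simp
      then have "(1 - y) powr 1 = (Q * P)\<^sup>2" unfolding PQ(3) using y by simp
      moreover have "(1 - y) powr (1 / 2) = Q * P" unfolding PQ(3)[symmetric] using y by (intro powr_half_sqrt) simp
      ultimately show ?thesis unfolding powr_diff by (simp add: power2_eq_square)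
    qed
    ultimately have H: "h y = u / u ^ 4 * (1 / (Q * P))" by (simp add: h_def)
    show ?thesis unfolding F G H using u(1) PQ(1,2)
      by (simp add: field_simps power2_eq_square power4_eq_xxxx)
  qed
  have ei: "einterval 0 1 = {0<..<1}" by (auto simp: einterval_def zero_ereal_def one_ereal_def)
  have sint: "set_integrable lborel {0<..<1} h"
    unfolding h_def by (rule set_integrable_subset[OF integrable_Beta[of "1 / 4" "1 / 2"]]) auto
  have i4: "set_integrable lborel {0<..<1} (\<lambda>y. 1 / 4 * h y)"
    using sint by (intro set_integrable_mult_right)
  have "filterlim g at_bot (at_right 0)" unfolding g_def by real_asymp
  then have tl0: "((ereal \<circ> g \<circ> real_of_ereal) \<longlongrightarrow> -\<infinity>) (at_right 0)"
    unfolding zero_ereal_def by (simp only: ereal_tendsto_simps)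
  have "isCont g 1" unfolding g_def by (intro continuous_intros) auto
  then have "(g \<longlongrightarrow> 0) (at_left 1)" by (auto simp: isCont_def g_def intro: filterlim_mono[OF _ order_refl at_le])
  then have tl1: "((ereal \<circ> g \<circ> real_of_ereal) \<longlongrightarrow> 0) (at_left 1)"
    unfolding zero_ereal_def one_ereal_def by (simp only: ereal_tendsto_simps)
  have pos: "0 < t\<^sup>2 + (sqrt 2)\<^sup>2" "0 < t\<^sup>2 + 1\<^sup>2" for t :: real by (simp_all add: add_nonneg_pos)
  have "agm_integral (sqrt 2) 1 = 2 * (LBINT t:{0<..}. f t)"
    using agm_integral_half(2)[of "sqrt 2" 1] by (simp add: f_def[abs_def])
  also have "(LBINT t:{0<..}. f t) = (LBINT t=-\<infinity>..0. f t)"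
    by (subst interval_integral_reflect) (simp add: interval_lebesgue_integral_def einterval_0_infinity f_def[abs_def])
  also have "\<dots> = (LBINT y=0..1. f (g y) * g' y)"
  proof (rule interval_integral_substitution_nonneg(2)[OF _ _ _ _ _ _ tl0 tl1])
    fix y :: real assume "0 < ereal y" "ereal y < 1"
    then have y: "0 < y" "y < 1" by auto
    have ne: "sqrt (1 / sqrt y - 1) \<noteq> 0" "sqrt y \<noteq> 0" using r[OF y] y by auto
    have "DERIV g y :> - ((0 * sqrt y - 1 * (inverse (sqrt y) / 2)) / (sqrt y * sqrt y) * (inverse (sqrt (1 / sqrt y - 1)) / 2))"
      unfolding g_def using r[OF y] y by (auto intro!: derivative_eq_intros)
    also have "- ((0 * sqrt y - 1 * (inverse (sqrt y) / 2)) / (sqrt y * sqrt y) * (inverse (sqrt (1 / sqrt y - 1)) / 2)) = g' y"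
      using y by (simp add: g'_def inverse_eq_divide)
    finally show "DERIV g y :> g' y" .
    show "isCont f (g y)" unfolding f_def
      using pos[of "g y"] by (intro continuous_intros) auto
    show "isCont g' y" unfolding g'_def using ne y by (intro continuous_intros) auto
    show "0 \<le> f (g y)" by (simp add: f_def)
  next
    fix y :: real assume "0 \<le> ereal y" "ereal y \<le> 1"
    then have y: "0 \<le> y" "y \<le> 1" by auto
    then have "sqrt (1 / sqrt y - 1) \<ge> 0 \<or> y = 0" by (auto simp: field_simps)
    then show "0 \<le> g' y" using y by (auto simp: g'_def)
  next
    show "set_integrable lborel (einterval 0 1) (\<lambda>y. f (g y) * g' y)"
      unfolding ei using i4
      by (rule set_integrable_cong[THEN iffD1, rotated -1]) (auto simp: key)
  qed simp
  also have "\<dots> = (LBINT y:{0<..<1}. f (g y) * g' y)"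
    by (simp add: interval_lebesgue_integral_def ei)
  also have "\<dots> = (LBINT y:{0<..<1}. 1 / 4 * h y)"
    by (intro set_lebesgue_integral_cong) (auto simp: key)
  also have "\<dots> = 1 / 4 * (LBINT y=0..1. h y)"
    by (simp add: interval_lebesgue_integral_def ei)
  also have "(LBINT y=0..1. h y) = (LBINT y:{0..1}. h y)"
    unfolding zero_ereal_def one_ereal_def by (rule interval_integral_Icc) simp
  also have "\<dots> = integral {0..1} h"
    unfolding h_def by (rule set_borel_integral_eq_integral[OF integrable_Beta]) auto
  also have "\<dots> = Beta (1 / 4) (1 / 2)"
    unfolding h_def by (rule integral_unique[OF has_integral_Beta_real]) auto
  finally show ?thesis by simp
qed

section \<open>The value of the theta function at 1\<close>

text \<open>
  Doubling the argument repeatedly does not change the integral, by the duplication identities and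
  Gauss's invariance, while both parameters tend to \<open>1\<close>, where the integral is \<open>\<pi>\<close>.
\<close>

lemma theta_agm: "agm_integral ((theta 1)\<^sup>2) ((theta_alt 1)\<^sup>2) = pi"
proof -
  define a b where "a k = (theta (2 ^ k))\<^sup>2" and "b k = (theta_alt (2 ^ k))\<^sup>2" for k :: nat
  have a0: "a k > 0" for k using theta_ge_1[of "2 ^ k"] by (simp add: a_def)
  have as: "a (Suc k) = (a k + b k) / 2" for k
    using theta_square_split(1)[of "2 ^ k"] by (simp add: a_def b_def)
  have bs': "(b (Suc k)) = theta (2 ^ k) * theta_alt (2 ^ k)" for k
    using theta_square_split(2)[of "2 ^ k"] by (simp add: b_def)
  have bs: "b (Suc k) = sqrt (a k * b k)" for k
  proof -
    have "a k * b k = (b (Suc k))\<^sup>2" unfolding bs' by (simp add: a_def b_def power_mult_distrib)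
    moreover have "b (Suc k) \<ge> 0" by (simp add: b_def)
    ultimately show ?thesis by (simp only: real_sqrt_abs abs_of_nonneg)
  qed
  have b0: "b k > 0" for k
  proof (induction k)
    case 0
    have "theta_alt 1 \<noteq> 0" using theta_alt_at_1 theta_ge_1[of 1] by auto
    then show ?case by (simp add: b_def)
  next
    case (Suc k)
    then show ?case unfolding bs using a0 by simp
  qed
  have inv: "agm_integral (a k) (b k) = agm_integral (a 0) (b 0)" for k
    by (induction k) (simp_all add: as bs agm_integral_step a0 b0)
  have la: "a \<longlonglongrightarrow> 1" unfolding a_def using tendsto_power[OF theta_tendsto_1, of 2] by simp
  have "(\<lambda>k. theta (2 ^ (k + 2))) \<longlonglongrightarrow> 1" using theta_tendsto_1 by (rule LIMSEQ_ignore_initial_segment)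
  then have "(\<lambda>k. (2 * theta (2 ^ (k + 2)) - theta (2 ^ k))\<^sup>2) \<longlonglongrightarrow> (2 * 1 - 1)\<^sup>2"
    by (intro tendsto_intros theta_tendsto_1)
  then have lb: "b \<longlonglongrightarrow> 1" unfolding b_def by (simp add: theta_alt_eq)
  define m M where "m k = min (a k) (b k)" and "M k = max (a k) (b k)" for k
  have "m \<longlonglongrightarrow> min 1 1" "M \<longlonglongrightarrow> max 1 1" unfolding m_def M_def by (intro tendsto_intros la lb)+
  then have mM: "m \<longlonglongrightarrow> 1" "M \<longlonglongrightarrow> 1" by simp_all
  have lim: "(\<lambda>k. pi / m k) \<longlonglongrightarrow> pi / 1" "(\<lambda>k. pi / M k) \<longlonglongrightarrow> pi / 1"
    by (intro tendsto_intros mM; simp)+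
  have bnd: "pi / M k \<le> agm_integral (a 0) (b 0)" "agm_integral (a 0) (b 0) \<le> pi / m k" for k
    using agm_integral_bounds(2,3)[of "m k" "a k" "b k" "M k"] a0[of k] b0[of k] inv[of k]
    by (auto simp: m_def M_def)
  have "agm_integral (a 0) (b 0) = pi"
    using LIMSEQ_le_const2[OF lim(2)] LIMSEQ_le_const[OF lim(1)] bnd by (auto intro!: antisym)
  then show ?thesis by (simp add: a_def b_def)
qed

theorem theta_at_1: "theta 1 = pi powr (1 / 4) / Gamma (3 / 4)"
proof -
  define A where "A = (theta 1)\<^sup>2"
  have A: "A > 0" using theta_ge_1[of 1] by (simp add: A_def)
  define B where "B = (theta_alt 1)\<^sup>2"
  have "2 * B\<^sup>2 = A\<^sup>2" using theta_alt_at_1 by (simp add: A_def B_def)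
  then have "B\<^sup>2 = (A / sqrt 2)\<^sup>2" by (simp add: power_divide)
  then have "B = A / sqrt 2"
    by (rule power2_eq_imp_eq) (use A in \<open>simp_all add: B_def\<close>)
  then have "pi = agm_integral A (A / sqrt 2)" using theta_agm by (simp only: A_def B_def)
  also have "\<dots> = agm_integral (A / sqrt 2 * sqrt 2) (A / sqrt 2 * 1)" by simp
  also have "\<dots> = Beta (1 / 4) (1 / 2) / 2 / (A / sqrt 2)"
    using A by (subst agm_integral_scale) (auto simp: agm_integral_lemniscate)
  finally have 1: "A = sqrt 2 * Beta (1 / 4) (1 / 2) / (2 * pi)"
    using A by (simp add: field_simps)
  have *: "complex_of_real (Gamma (1 / 4) * Gamma (3 / 4)) = complex_of_real (pi / sin (pi / 4))"
    using Gamma_reflection_complex[of "of_real (1 / 4)"]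
    by (simp flip: Gamma_complex_of_real sin_of_real)
  have "Gamma (1 / 4) * Gamma (3 / 4) = pi * sqrt 2"
  proof -
    have "pi / sin (pi / 4) = pi * (2 / sqrt 2)" by (simp add: sin_45)
    also have "2 / sqrt 2 = sqrt 2" by (rule real_div_sqrt) simp
    finally show ?thesis using * by (simp only: of_real_eq_iff)
  qed
  then have "Gamma (1 / 4) = pi * sqrt 2 / Gamma (3 / 4)"
    using Gamma_real_pos[of "3/4"] by (subst nonzero_eq_divide_eq) auto
  then have 2: "Beta (1 / 4) (1 / 2 :: real) = pi * sqrt 2 * sqrt pi / (Gamma (3 / 4))\<^sup>2"
    by (simp add: Beta_def Gamma_one_half_real power2_eq_square)
  have "r * (pi * r * p / g) / (2 * pi) = r\<^sup>2 / 2 * (p / g)" for r p g :: real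
    by (simp add: power2_eq_square)
  then have "A = (sqrt 2)\<^sup>2 / 2 * (sqrt pi / (Gamma (3 / 4))\<^sup>2)"
    unfolding 1 2 by blast
  then have "A = sqrt pi / (Gamma (3 / 4))\<^sup>2"
    by simp
  also have "\<dots> = (pi powr (1 / 4) / Gamma (3 / 4))\<^sup>2"
    by (simp add: power_divide powr_power powr_half_sqrt)
  finally show ?thesis unfolding A_def
    by (rule power2_eq_imp_eq) (use theta_ge_1[of 1] Gamma_real_pos[of "3/4"] in auto)
qed

section \<open>The analytic continuation of the zeta function\<close>

definition psi :: "real \<Rightarrow> real" where
  "psi x = (\<Sum>n. exp (- (pi * (real (Suc n))\<^sup>2 * x)))"

lemma psi_sums:
  assumes x: "x > 0"
  shows "(\<lambda>n. exp (- (pi * (real (Suc n))\<^sup>2 * x))) sums ((theta x - 1) / 2)"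
proof -
  define e where "e n = exp (- (pi * x * (of_int n)\<^sup>2))" for n :: int
  have e: "(e has_sum theta x) UNIV" unfolding e_def by (rule theta_has_sum[OF x])
  define p where "p = infsum e {0<..}"
  have p: "(e has_sum p) {0<..}" unfolding p_def
    by (intro has_sum_infsum summable_on_subset_banach[OF has_sum_imp_summable[OF e]]) auto
  have bij: "bij_betw (\<lambda>n::int. - n) {..<0} {0<..}"
    by (rule bij_betwI[where g = "\<lambda>n. - n"]) auto
  have "((\<lambda>n. e (- n)) has_sum p) {..<0}"
    unfolding has_sum_reindex_bij_betw[OF bij] by (rule p)
  then have p': "(e has_sum p) {..<0}" by (simp add: e_def[abs_def])
  have 0: "(e has_sum 1) {0}" using has_sum_finite[of "{0}" e] by (simp add: e_def)
  have "(e has_sum (1 + (p + p))) ({0} \<union> ({0<..} \<union> {..<0}))"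
    by (intro has_sum_Un_disjoint 0 p p') auto
  also have "{0} \<union> ({0<..} \<union> {..<0}) = (UNIV :: int set)" by auto
  finally have "theta x = 1 + (p + p)" using e has_sum_unique by blast
  then have th: "(theta x - 1) / 2 = p" by simp
  have bij2: "bij_betw (\<lambda>n. int (Suc n)) UNIV {0<..}"
    by (rule bij_betwI[where g = "\<lambda>n. nat (n - 1)"]) auto
  have "((\<lambda>n. e (int (Suc n))) has_sum p) UNIV"
    unfolding has_sum_reindex_bij_betw[OF bij2] by (rule p)
  then have "(\<lambda>n. e (int (Suc n))) sums p" by (rule has_sum_imp_sums)
  moreover have "e (int (Suc n)) = exp (- (pi * (real (Suc n))\<^sup>2 * x))" for n
    by (simp add: e_def algebra_simps)
  ultimately show ?thesis unfolding th by simp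
qed

lemma psi_eq: "x > 0 \<Longrightarrow> psi x = (theta x - 1) / 2"
  unfolding psi_def by (rule sums_unique[symmetric]) (rule psi_sums)

lemma sums_psi: "x > 0 \<Longrightarrow> (\<lambda>n. exp (- (pi * (real (Suc n))\<^sup>2 * x))) sums psi x"
  using psi_sums psi_eq by metis

lemma psi_nonneg: "x > 0 \<Longrightarrow> psi x \<ge> 0"
  using psi_eq[of x] theta_ge_1[of x] by simp

lemma psi_le:
  assumes x: "x \<ge> 1"
  shows "psi x \<le> psi 1 * exp pi * exp (- (pi * x))"
proof -
  have "psi x \<le> exp (- (pi * (x - 1))) * psi 1"
    using theta_minus_1_le[OF x] x by (simp add: psi_eq)
  also have "exp (- (pi * (x - 1))) = exp pi * exp (- (pi * x))"
    by (simp add: algebra_simps flip: exp_add)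
  finally show ?thesis by (simp only: mult_ac)
qed

lemma psi_inverse:
  assumes x: "x > 0"
  shows "psi (1 / x) = sqrt x * psi x + sqrt x / 2 - 1 / 2"
  using theta_functional_equation[OF x] x by (simp add: psi_eq field_simps)

lemma psi_measurable [measurable]: "psi \<in> borel_measurable borel"
  unfolding psi_def by measurable

lemma Gamma_integral_exp_scaled:
  assumes A: "A > 0" and w: "Re w > 0"
  shows "has_bochner_integral lborel (\<lambda>y. exp (w * of_real y - of_real (A * exp y)))
           (Gamma w * exp (- (w * of_real (ln A))))"
proof -
  have "has_bochner_integral lborel (\<lambda>y. exp (w * of_real y - of_real (exp y))) (Gamma w)"
    using Gamma_integral_exp[OF w] by (simp add: has_bochner_integral_iff)
  then have "has_bochner_integral lborel
      (\<lambda>y. exp (w * of_real (ln A + 1 * y) - of_real (exp (ln A + 1 * y)))) (Gamma w /\<^sub>R \<bar>1\<bar>)"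
    by (subst lborel_has_bochner_integral_real_affine_iff[symmetric]) auto
  from has_bochner_integral_mult_left[OF this, of "exp (- (w * of_real (ln A)))"]
  have "has_bochner_integral lborel
      (\<lambda>y. exp (w * of_real (ln A + y) - of_real (A * exp y)) * exp (- (w * of_real (ln A))))
      (Gamma w * exp (- (w * of_real (ln A))))"
    using A by (simp add: exp_add)
  then show ?thesis
    by (rule has_bochner_integral_cong[THEN iffD1, OF refl _ refl, rotated])
       (simp add: algebra_simps flip: exp_add)
qed

lemma integral_exp_half_line:
  assumes w: "Re w > 0"
  shows "set_integrable lborel {0<..} (\<lambda>y. exp (- (w * of_real y)))"
    and "(LBINT y:{0<..}. exp (- (w * of_real y))) = 1 / w"
proof -
  have w0: "w \<noteq> 0" using w by auto
  have n: "norm (exp (- (w * of_real y))) = exp (- (Re w * y))" for y by simp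
  have ei: "einterval 0 \<infinity> = {0<..}" by (auto simp: einterval_def)
  have t0: "(((\<lambda>y. - exp (- (Re w * y)) / Re w) \<circ> real_of_ereal) \<longlongrightarrow> - 1 / Re w) (at_right 0)"
  proof -
    have "((\<lambda>y. - exp (- (Re w * y)) / Re w) \<longlongrightarrow> - exp (- (Re w * 0)) / Re w) (at_right 0)"
      using w by (intro tendsto_intros) auto
    then show ?thesis unfolding zero_ereal_def by (simp only: ereal_tendsto_simps) simp
  qed
  have lim: "((\<lambda>y. exp (- (Re w * y))) \<longlongrightarrow> 0) at_top" using w by real_asymp
  have t1: "(((\<lambda>y. - exp (- (Re w * y)) / Re w) \<circ> real_of_ereal) \<longlongrightarrow> 0) (at_left \<infinity>)"
    using tendsto_divide[OF tendsto_minus[OF lim] tendsto_const[of "Re w"]] w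
    by (simp only: ereal_tendsto_simps) simp
  have "set_integrable lborel (einterval 0 \<infinity>) (\<lambda>y. exp (- (Re w * y)))"
    by (rule interval_integral_FTC_nonneg(1)[OF _ _ _ _ t0 t1])
       (use w in \<open>auto intro!: derivative_eq_intros continuous_intros\<close>)
  then show si: "set_integrable lborel {0<..} (\<lambda>y. exp (- (w * of_real y)))"
    unfolding ei by (rule set_integrable_bound) (auto simp: set_borel_measurable_def)
  have T0: "(((\<lambda>y. - exp (- (w * of_real y)) / w) \<circ> real_of_ereal) \<longlongrightarrow> - 1 / w) (at_right 0)"
  proof -
    have "((\<lambda>y. - exp (- (w * of_real y)) / w) \<longlongrightarrow> - exp (- (w * of_real 0)) / w) (at_right 0)"
      using w0 by (intro tendsto_intros) auto
    then show ?thesis unfolding zero_ereal_def by (simp only: ereal_tendsto_simps) simp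
  qed
  have Lim: "((\<lambda>y. exp (- (w * of_real y))) \<longlongrightarrow> 0) at_top"
    by (rule tendsto_norm_zero_cancel) (use lim in \<open>simp only: n\<close>)
  have T1: "(((\<lambda>y. - exp (- (w * of_real y)) / w) \<circ> real_of_ereal) \<longlongrightarrow> 0) (at_left \<infinity>)"
    using tendsto_divide[OF tendsto_minus[OF Lim] tendsto_const[of w]] w0
    by (simp only: ereal_tendsto_simps) simp
  have "(LBINT y=0..\<infinity>. exp (- (w * of_real y))) = 0 - (- 1 / w)"
  proof (rule interval_integral_FTC_integrable[OF _ _ _ _ T0 T1])
    fix x :: real
    have "((\<lambda>z. - exp (- (w * z)) / w) has_field_derivative exp (- (w * of_real x))) (at (of_real x))"
      using w0 by (auto intro!: derivative_eq_intros)
    then show "((\<lambda>y. - exp (- (w * of_real y)) / w) has_vector_derivative exp (- (w * of_real x))) (at x)"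
      by (rule has_vector_derivative_real_field)
    show "isCont (\<lambda>x. exp (- (w * of_real x))) x" by (intro continuous_intros)
  qed (use si ei in auto)
  then show "(LBINT y:{0<..}. exp (- (w * of_real y))) = 1 / w"
    by (simp add: interval_lebesgue_integral_def ei)
qed

lemma integral_reflect_split:
  fixes f :: "real \<Rightarrow> complex"
  assumes f: "integrable lborel f"
  shows "(LBINT y. f y) = (LBINT y:{0<..}. f y) + (LBINT y:{0<..}. f (- y))"
proof -
  have i: "integrable lborel (\<lambda>y. indicator A y *\<^sub>R f y)" if "A \<in> sets borel" for A
    using that f by (intro integrable_mult_indicator) auto
  have [measurable]: "f \<in> borel_measurable borel" using borel_measurable_integrable[OF f] by simp
  have "(LBINT y. f y) = (LBINT y. indicator {0<..} y *\<^sub>R f y + indicator {..<0} y *\<^sub>R f y)"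
  proof (rule integral_cong_AE)
    show "AE y in lborel. f y = indicator {0<..} y *\<^sub>R f y + indicator {..<0} y *\<^sub>R f y"
      using AE_lborel_singleton[of "0::real"] by eventually_elim (auto simp: indicator_def)
  qed measurable
  also have "\<dots> = (LBINT y. indicator {0<..} y *\<^sub>R f y) + (LBINT y. indicator {..<0} y *\<^sub>R f y)"
    by (intro Bochner_Integration.integral_add i) auto
  also have "(LBINT y. indicator {..<0} y *\<^sub>R f y) = \<bar>- 1\<bar> *\<^sub>R (LBINT y. indicator {..<0} (0 + - 1 * y) *\<^sub>R f (0 + - 1 * y))"
    by (rule lborel_integral_real_affine) auto
  also have "\<dots> = (LBINT y. indicator {0<..} y *\<^sub>R f (- y))"
    by (simp add: indicator_def)
  finally show ?thesis by (simp add: set_lebesgue_integral_def)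
qed

definition psi_mellin :: "complex \<Rightarrow> complex" where
  "psi_mellin z = (LBINT y:{0<..}. of_real (psi (exp y)) * exp (z * of_real y))"

lemma set_integrable_exp_exp:
  assumes A: "A > 0"
  shows "set_integrable lborel {0<..} (\<lambda>y. exp (w * of_real y - of_real (A * exp y)) :: complex)"
proof -
  \<comment> \<open>for positive \<open>y\<close> the exponent may be enlarged until Euler's integral over the whole line converges\<close>
  define a where "a = \<bar>Re w\<bar> + 1"
  have "integrable lborel (\<lambda>y. exp (of_real a * of_real y - of_real (A * exp y)) :: complex)"
    using Gamma_integral_exp_scaled[OF A, of "of_real a"] by (auto simp: a_def has_bochner_integral_iff)
  then show ?thesis
    unfolding set_integrable_def
  proof (rule Bochner_Integration.integrable_bound)
    show "AE y in lborel. norm (indicator {0<..} y *\<^sub>R exp (w * of_real y - of_real (A * exp y)))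
          \<le> norm (exp (of_real a * of_real y - of_real (A * exp y)) :: complex)"
    proof (intro AE_I2)
      fix y :: real
      have "Re w * y \<le> a * y" if "y > 0" using that by (intro mult_right_mono) (auto simp: a_def)
      then show "norm (indicator {0<..} y *\<^sub>R exp (w * of_real y - of_real (A * exp y)))
          \<le> norm (exp (of_real a * of_real y - of_real (A * exp y)) :: complex)"
        by (cases "y > 0") auto
    qed
  qed measurable
qed

lemma psi_mellin_integrable:
  "set_integrable lborel {0<..} (\<lambda>y. of_real (psi (exp y)) * exp (z * of_real y) :: complex)"
proof -
  have "integrable lborel (\<lambda>y. of_real (psi 1 * exp pi) * (indicator {0<..} y *\<^sub>R exp (z * of_real y - of_real (pi * exp y))))"
    using set_integrable_exp_exp[of pi z] unfolding set_integrable_def by (intro integrable_mult_right) auto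
  then show ?thesis
    unfolding set_integrable_def
  proof (rule Bochner_Integration.integrable_bound)
    show "AE y in lborel. norm (indicator {0<..} y *\<^sub>R (of_real (psi (exp y)) * exp (z * of_real y)))
          \<le> norm (of_real (psi 1 * exp pi) * (indicator {0<..} y *\<^sub>R exp (z * of_real y - of_real (pi * exp y))))"
    proof (intro AE_I2)
      fix y :: real
      show "norm (indicator {0<..} y *\<^sub>R (of_real (psi (exp y)) * exp (z * of_real y)))
          \<le> norm (of_real (psi 1 * exp pi) * (indicator {0<..} y *\<^sub>R exp (z * of_real y - of_real (pi * exp y))))"
      proof (cases "y > 0")
        case True
        then have "psi (exp y) * exp (Re z * y) \<le> (psi 1 * exp pi * exp (- (pi * exp y))) * exp (Re z * y)"
          by (intro mult_right_mono psi_le) auto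
        also have "\<dots> = psi 1 * exp pi * exp (Re z * y - pi * exp y)"
          by (simp add: algebra_simps flip: exp_add)
        finally show ?thesis
          using True psi_nonneg[of 1] psi_nonneg[of "exp y"] by (simp add: norm_mult)
      qed auto
    qed
  qed measurable
qed

lemma sums_integral_dominated:
  fixes f :: "nat \<Rightarrow> real \<Rightarrow> complex"
  assumes [measurable]: "\<And>k. f k \<in> borel_measurable lborel"
    and m: "integrable lborel m"
    and le: "\<And>n y. (\<Sum>k<n. norm (f k y)) \<le> m y"
    and F: "\<And>y. (\<lambda>k. f k y) sums F y"
  shows "integrable lborel F" and "(\<lambda>k. LBINT y. f k y) sums (LBINT y. F y)"
proof -
  have int: "integrable lborel (f k)" for k
    using m
  proof (rule Bochner_Integration.integrable_bound)
    show "AE y in lborel. norm (f k y) \<le> norm (m y)"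
    proof (intro AE_I2)
      fix y
      have "norm (f k y) \<le> (\<Sum>k<Suc k. norm (f k y))" by (simp add: sum_nonneg)
      also have "\<dots> \<le> norm (m y)" using le[where n = "Suc k" and y = y] by simp
      finally show "norm (f k y) \<le> norm (m y)" .
    qed
  qed measurable
  have ns: "summable (\<lambda>k. norm (f k y))" for y
    by (rule summableI_nonneg_bounded[where x = "m y"]) (use le in auto)
  have summ: "summable (\<lambda>k. LBINT y. norm (f k y))"
  proof (rule summableI_nonneg_bounded)
    fix n
    have "(\<Sum>k<n. LBINT y. norm (f k y)) = (LBINT y. (\<Sum>k<n. norm (f k y)))"
      using int by (intro Bochner_Integration.integral_sum[symmetric]) auto
    also have "\<dots> \<le> (LBINT y. m y)"
      using int m le by (intro integral_mono) auto
    finally show "(\<Sum>k<n. LBINT y. norm (f k y)) \<le> (LBINT y. m y)" .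
  qed auto
  have *: "(\<Sum>k. f k y) = F y" for y using F by (rule sums_unique[symmetric])
  show "integrable lborel F"
    using integrable_suminf[OF int _ summ] ns by (simp add: *)
  show "(\<lambda>k. LBINT y. f k y) sums (LBINT y. F y)"
    using sums_integral[OF int _ summ] ns by (simp add: *)
qed

text \<open>
  Expanding the exponential gives a power series in the parameter that converges everywhere; this
  is how \<open>psi_mellin\<close> is seen to be entire.
\<close>

lemma psi_mellin_sums:
  fixes w :: complex
  shows "(\<lambda>k. (LBINT y:{0<..}. of_real (psi (exp y) * y ^ k / fact k)) * w ^ k) sums psi_mellin w"
proof -
  define f where "f k y = indicator {0<..} y *\<^sub>R (of_real (psi (exp y)) * ((w * of_real y) ^ k /\<^sub>R fact k))" for k y
  define F where "F y = indicator {0<..} y *\<^sub>R (of_real (psi (exp y)) * exp (w * of_real y))" for y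
  define m where "m y = indicator {0<..} y *\<^sub>R (psi (exp y) * exp (norm w * y))" for y
  have m: "integrable lborel m"
    using integrable_norm[OF psi_mellin_integrable[of "of_real (norm w)", unfolded set_integrable_def]]
    by (rule Bochner_Integration.integrable_cong[THEN iffD1, OF refl, rotated])
       (auto simp: m_def indicator_def norm_mult psi_nonneg)
  have nf: "norm (f k y) = indicator {0<..} y *\<^sub>R (psi (exp y) * ((norm w * y) ^ k /\<^sub>R fact k))" for k y
    by (auto simp: f_def norm_mult norm_power indicator_def psi_nonneg norm_divide)
  have nsum: "(\<lambda>k. norm (f k y)) sums m y" for y
    unfolding nf m_def by (intro sums_scaleR_right sums_mult exp_converges)
  have sum_le: "(\<Sum>k<n. norm (f k y)) \<le> m y" for n y
    using sum_le_suminf[OF sums_summable[OF nsum[of y]], of "{..<n}"] sums_unique[OF nsum[of y]] by simp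
  have "(\<lambda>k. LBINT y. f k y) sums (LBINT y. F y)"
  proof (rule sums_integral_dominated(2)[OF _ m sum_le])
    show "f k \<in> borel_measurable lborel" for k unfolding f_def by measurable
    show "(\<lambda>k. f k y) sums F y" for y
      unfolding f_def F_def by (intro sums_scaleR_right sums_mult exp_converges)
  qed
  moreover have "(LBINT y. f k y) = (LBINT y:{0<..}. of_real (psi (exp y) * y ^ k / fact k)) * w ^ k" for k
  proof -
    have "f k y = (indicator {0<..} y *\<^sub>R of_real (psi (exp y) * y ^ k / fact k)) * w ^ k" for y
      by (simp add: f_def power_mult_distrib scaleR_conv_of_real divide_inverse)
    then show ?thesis by (simp only: set_lebesgue_integral_def integral_mult_left_zero)
  qed
  ultimately show ?thesis by (simp only: psi_mellin_def set_lebesgue_integral_def F_def)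
qed

lemma psi_mellin_holomorphic: "psi_mellin holomorphic_on A"
proof -
  define a where "a k = (LBINT y:{0<..}. complex_of_real (psi (exp y) * y ^ k / fact k))" for k
  have "(\<lambda>k. a k * w ^ k) sums psi_mellin w" for w unfolding a_def by (rule psi_mellin_sums)
  then have "psi_mellin holomorphic_on ball 0 r" for r
    by (intro power_series_holomorphic[where a = a]) simp
  then have "psi_mellin analytic_on {z}" for z
    unfolding analytic_at by (intro exI[of _ "ball 0 (norm z + 1)"]) auto
  then have "psi_mellin analytic_on A" by (meson analytic_on_analytic_at)
  then show ?thesis by (rule analytic_imp_holomorphic)
qed

text \<open>
  Riemann's formula for the entire function \<open>xi\<close>; the symmetry under \<open>s \<mapsto> 1 - s\<close> is visible.
\<close>

definition xi_entire :: "complex \<Rightarrow> complex" where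
  "xi_entire s = 1 / 2 - s * (1 - s) / 2 * (psi_mellin (s / 2) + psi_mellin ((1 - s) / 2))"

lemma xi_entire_holomorphic: "xi_entire holomorphic_on A"
  unfolding xi_entire_def
  by (intro holomorphic_intros holomorphic_on_compose_gen[OF _ psi_mellin_holomorphic[of UNIV], unfolded o_def]) auto

lemma dirichlet_summable:
  assumes "a > (1::real) / 2"
  shows "summable (\<lambda>n. exp (- (a * ln (pi * (real (Suc n))\<^sup>2))))"
proof -
  have "exp (- (a * ln (pi * (real (Suc n))\<^sup>2))) = exp (- (a * ln pi)) * real (Suc n) powr (- (2 * a))" for n
  proof -
    have "ln (pi * (real (Suc n))\<^sup>2) = ln pi + 2 * ln (real (Suc n))"
      by (simp add: ln_mult ln_realpow del: of_nat_Suc)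
    then show ?thesis by (simp add: powr_def algebra_simps flip: exp_add del: of_nat_Suc)
  qed
  moreover have "summable (\<lambda>n. real (Suc n) powr (- (2 * a)))"
    using assms by (subst summable_Suc_iff) (simp add: summable_real_powr_iff)
  ultimately show ?thesis by (simp only:) (rule summable_mult)
qed

text \<open>
  Riemann's computation. Termwise integration of \<open>psi (exp y) * exp (a y)\<close> over the real line gives
  the left-hand series; folding the negative half-line onto the positive one by the functional
  equation of theta gives the right-hand side, in which both half-line transforms are entire and the
  two rational terms carry the poles.
\<close>

lemma theta_mellin:
  assumes a: "Re a > 1 / 2"
  shows "(\<lambda>n. Gamma a * exp (- (a * of_real (ln (pi * (real (Suc n))\<^sup>2))))) sums
           (psi_mellin a + psi_mellin (1 / 2 - a) + 1 / (2 * a - 1) - 1 / (2 * a))"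
proof -
  define c where "c n = pi * (real (Suc n))\<^sup>2" for n
  have c: "c n > 0" for n by (simp add: c_def)
  define f where "f n y = exp (a * of_real y - of_real (c n * exp y))" for n y
  define F where "F y = of_real (psi (exp y)) * exp (a * of_real y)" for y
  have f: "has_bochner_integral lborel (f n) (Gamma a * exp (- (a * of_real (ln (c n)))))" for n
    unfolding f_def using a by (intro Gamma_integral_exp_scaled c) auto
  have nf: "norm (f n y) = exp (Re a * y - c n * exp y)" for n y by (simp add: f_def)
  have "has_bochner_integral lborel (\<lambda>y. complex_of_real (norm (f n y))) (Gamma (of_real (Re a)) * exp (- (of_real (Re a) * of_real (ln (c n)))))" for n
    using Gamma_integral_exp_scaled[OF c[of n], of "of_real (Re a)"] a
    by (simp add: nf flip: exp_of_real)
  then have "complex_of_real (LBINT y. norm (f n y)) = of_real (Gamma (Re a) * exp (- (Re a * ln (c n))))" for n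
    by (simp add: has_bochner_integral_iff Gamma_complex_of_real flip: exp_of_real)
  then have nint: "(LBINT y. norm (f n y)) = Gamma (Re a) * exp (- (Re a * ln (c n)))" for n
    by (simp only: of_real_eq_iff)
  have fs: "(\<lambda>n. f n y) sums F y" for y
  proof -
    have "(\<lambda>n. exp (a * of_real y) * of_real (exp (- (c n * exp y)))) sums (exp (a * of_real y) * of_real (psi (exp y)))"
      unfolding c_def by (intro sums_mult sums_of_real sums_psi) auto
    then show ?thesis by (simp add: f_def F_def exp_diff exp_minus field_simps flip: exp_of_real)
  qed
  have nfs: "summable (\<lambda>n. norm (f n y))" for y
  proof -
    have "summable (\<lambda>n. exp (Re a * y) * exp (- (c n * exp y)))"
      unfolding c_def by (intro summable_mult sums_summable[OF sums_psi]) auto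
    then show ?thesis unfolding nf by (simp flip: exp_add)
  qed
  have "summable (\<lambda>n. LBINT y. norm (f n y))"
    unfolding nint c_def by (intro summable_mult dirichlet_summable a)
  then have S: "(\<lambda>n. LBINT y. f n y) sums (LBINT y. \<Sum>n. f n y)" "integrable lborel (\<lambda>y. \<Sum>n. f n y)"
    using f nfs by (intro sums_integral integrable_suminf; auto simp: has_bochner_integral_iff)+
  have "(\<Sum>n. f n y) = F y" for y using fs by (rule sums_unique[symmetric])
  with S have S: "(\<lambda>n. LBINT y. f n y) sums (LBINT y. F y)" and iF: "integrable lborel F" by simp_all
  define G where "G w y = of_real (psi (exp y)) * exp (w * of_real y)" for w :: complex and y :: real
  have "(LBINT y. F y) = psi_mellin a + (LBINT y:{0<..}. F (- y))"
    using integral_reflect_split[OF iF] by (simp add: psi_mellin_def F_def)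
  also have "(LBINT y:{0<..}. F (- y)) = (LBINT y:{0<..}. (G (1 / 2 - a) y + 1 / 2 * exp (- ((a - 1 / 2) * of_real y))) - 1 / 2 * exp (- (a * of_real y)))"
  proof (intro set_lebesgue_integral_cong allI impI)
    fix y :: real
    have h: "sqrt (exp y) = exp (y / 2)" by (rule real_sqrt_unique) (simp_all flip: exp_double)
    have "psi (exp (- y)) = exp (y / 2) * psi (exp y) + exp (y / 2) / 2 - 1 / 2"
      using psi_inverse[of "exp y"] by (simp add: exp_minus h inverse_eq_divide)
    then have "F (- y) = (exp (of_real y / 2) * of_real (psi (exp y)) + exp (of_real y / 2) / 2 - 1 / 2) * exp (- (a * of_real y))"
      by (simp add: F_def flip: exp_of_real)
    also have "\<dots> = of_real (psi (exp y)) * (exp (of_real y / 2) * exp (- (a * of_real y)))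
         + 1 / 2 * (exp (of_real y / 2) * exp (- (a * of_real y))) - 1 / 2 * exp (- (a * of_real y))"
      by (simp add: algebra_simps)
    also have "exp (of_real y / 2) * exp (- (a * of_real y)) = exp ((1 / 2 - a) * of_real y)"
      by (simp add: algebra_simps flip: exp_add)
    also have "exp ((1 / 2 - a) * of_real y) = exp (- ((a - 1 / 2) * of_real y))" 
      by (simp add: algebra_simps)
    finally show "F (- y) = (G (1 / 2 - a) y + 1 / 2 * exp (- ((a - 1 / 2) * of_real y))) - 1 / 2 * exp (- (a * of_real y))"
      by (simp add: G_def algebra_simps)
  qed auto
  also have "\<dots> = (psi_mellin (1 / 2 - a) + 1 / 2 * (1 / (a - 1 / 2))) - 1 / 2 * (1 / a)"
  proof -
    have i0: "set_integrable lborel {0<..} (G (1 / 2 - a))" unfolding G_def by (rule psi_mellin_integrable)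
    have a1: "Re (a - 1 / 2) > 0" and a2: "Re a > 0" using a by auto
    note i1 = integral_exp_half_line[OF a1] and i2 = integral_exp_half_line[OF a2]
    have j1: "set_integrable lborel {0<..} (\<lambda>y. 1 / 2 * exp (- ((a - 1 / 2) * of_real y)))"
      and j2: "set_integrable lborel {0<..} (\<lambda>y. 1 / 2 * exp (- (a * of_real y)))"
      using i1(1) i2(1) by (intro set_integrable_mult_right; simp)+
    have v1: "(LBINT y:{0<..}. 1 / 2 * exp (- ((a - 1 / 2) * of_real y))) = 1 / 2 * (1 / (a - 1 / 2))"
      and v2: "(LBINT y:{0<..}. 1 / 2 * exp (- (a * of_real y))) = 1 / 2 * (1 / a)"
      by (simp_all only: set_integral_mult_right i1(2) i2(2))
    show ?thesis
      unfolding set_integral_diff(2)[OF set_integral_add(1)[OF i0 j1] j2] set_integral_add(2)[OF i0 j1] v1 v2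
      by (simp only: psi_mellin_def G_def[abs_def])
  qed
  also have "1 / 2 * (1 / (a - 1 / 2)) = 1 / (2 * a - 1)" by (simp add: field_simps)
  finally have "(LBINT y. F y) = psi_mellin a + psi_mellin (1 / 2 - a) + 1 / (2 * a - 1) - 1 / (2 * a)"
    by simp
  with S f show ?thesis by (simp add: has_bochner_integral_iff c_def)
qed

lemma pi_powr: "complex_of_real pi powr z = exp (z * of_real (ln pi))"
  by (simp add: powr_def Ln_of_real)

text \<open>
  The continuation of zeta, read off from \<open>xi_entire\<close>. The reciprocal Gamma function being entire,
  the only singularity is at \<open>1\<close>, where the value \<open>0\<close> matches the convention in the definition of
  \<open>zeta\<close>.
\<close>

definition zeta_cont :: "complex \<Rightarrow> complex" where
  "zeta_cont s = (if s = 1 then 0 else of_real pi powr (s / 2) * rGamma (1 + s / 2) * xi_entire s / (s - 1))"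

lemma zeta_cont_dirichlet:
  assumes s: "Re s > 1"
  shows "(\<lambda>n. 1 / of_nat (Suc n) powr s) sums zeta_cont s"
proof -
  define a where "a = s / 2"
  have a: "Re a > 1 / 2" using s by (simp add: a_def)
  have s2: "s = 2 * a" by (simp add: a_def)
  define S where "S = psi_mellin a + psi_mellin (1 / 2 - a) + 1 / (2 * a - 1) - 1 / (2 * a)"
  have nz: "a \<noteq> 0" "2 * a - 1 \<noteq> 0" "s \<noteq> 1" using a s by (auto simp: complex_eq_iff)
  have G0: "Gamma a \<noteq> 0" using a by (auto simp: Gamma_eq_zero_iff elim!: nonpos_Ints_cases)
  have e: "exp (- (a * of_real (ln (pi * (real (Suc n))\<^sup>2)))) = exp (- (a * of_real (ln pi))) * (1 / of_nat (Suc n) powr s)" for n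
  proof -
    have "ln (pi * (real (Suc n))\<^sup>2) = ln pi + 2 * ln (real (Suc n))"
      by (simp add: ln_mult ln_realpow del: of_nat_Suc)
    moreover have "of_nat (Suc n) powr s = exp (s * of_real (ln (real (Suc n))))"
      by (simp add: powr_def Ln_of_nat del: of_nat_Suc)
    ultimately have "1 / of_nat (Suc n) powr s = exp (- (s * of_real (ln (real (Suc n)))))"
      and "complex_of_real (ln (pi * (real (Suc n))\<^sup>2)) = of_real (ln pi) + 2 * of_real (ln (real (Suc n)))"
      by (simp_all only: exp_minus inverse_eq_divide of_real_add of_real_mult of_real_numeral)
    then show ?thesis by (simp only: s2) (simp add: algebra_simps flip: exp_add)
  qed
  have "(\<lambda>n. (Gamma a * exp (- (a * of_real (ln pi)))) * (1 / of_nat (Suc n) powr s)) sums S"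
    using theta_mellin[OF a] unfolding e S_def by (simp only: mult_ac)
  from sums_mult[OF this, of "exp (a * of_real (ln pi)) / Gamma a"]
  have "(\<lambda>n. (exp (a * of_real (ln pi)) / Gamma a * (Gamma a * exp (- (a * of_real (ln pi))))) * (1 / of_nat (Suc n) powr s))
      sums (exp (a * of_real (ln pi)) / Gamma a * S)" by (simp only: mult_ac)
  moreover have "exp (a * of_real (ln pi)) / Gamma a * (Gamma a * exp (- (a * of_real (ln pi)))) = 1"
    using G0 by (simp add: exp_minus)
  ultimately have "(\<lambda>n. 1 / of_nat (Suc n) powr s) sums (exp (a * of_real (ln pi)) / Gamma a * S)"
    by simp
  moreover have "zeta_cont s = exp (a * of_real (ln pi)) / Gamma a * S"
  proof -
    have X: "xi_entire s = a * (s - 1) * S"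
    proof -
      have h: "(1 - s) / 2 = 1 / 2 - a" by (simp add: a_def diff_divide_distrib)
      have "a * (s - 1) * (1 / (2 * a - 1) - 1 / (2 * a)) = 1 / 2"
        using nz by (simp add: s2 field_simps)
      moreover have "a * (s - 1) * S = a * (s - 1) * (psi_mellin a + psi_mellin (1 / 2 - a)) +
          a * (s - 1) * (1 / (2 * a - 1) - 1 / (2 * a))"
        by (simp add: S_def algebra_simps)
      ultimately have "a * (s - 1) * S = a * (s - 1) * (psi_mellin a + psi_mellin (1 / 2 - a)) + 1 / 2" by simp
      moreover have "s * (1 - s) / 2 = - (a * (s - 1))" by (simp add: a_def field_simps)
      ultimately show ?thesis unfolding xi_entire_def h a_def[symmetric] by simp
    qed
    have "rGamma (1 + a) = 1 / (a * Gamma a)"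
    proof -
      have "a \<notin> \<int>\<^sub>\<le>\<^sub>0" using a by (auto elim!: nonpos_Ints_cases)
      then show ?thesis using Gamma_plus1[of a] by (simp add: rGamma_inverse_Gamma add.commute inverse_eq_divide)
    qed
    then show ?thesis
      using nz G0 by (simp add: zeta_cont_def X pi_powr flip: a_def)
  qed
  ultimately show ?thesis by simp
qed

text \<open>
  The definite description is met by \<open>zeta_cont\<close>, and by no other function because the punctured
  plane is connected.
\<close>

lemma zeta_eq_zeta_cont: "zeta = zeta_cont"
  unfolding zeta_def
proof (rule the_equality)
  have "zeta_cont holomorphic_on - {1}"
  proof (rule holomorphic_transform)
    show "(\<lambda>s. of_real pi powr (s / 2) * rGamma (1 + s / 2) * xi_entire s / (s - 1)) holomorphic_on - {1}"
      unfolding pi_powr by (intro holomorphic_intros xi_entire_holomorphic) auto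
  qed (auto simp: zeta_cont_def)
  moreover have "zeta_cont s = (\<Sum>n. 1 / of_nat (Suc n) powr s)" if "Re s > 1" for s
    using sums_unique[OF zeta_cont_dirichlet[OF that]] by simp
  ultimately show Z: "zeta_cont holomorphic_on (- {1}) \<and>
      (\<forall>s. Re s > 1 \<longrightarrow> zeta_cont s = (\<Sum>n. 1 / of_nat (Suc n) powr s)) \<and> zeta_cont 1 = 0"
    by (simp add: zeta_cont_def)
  fix f :: "complex \<Rightarrow> complex"
  assume f: "f holomorphic_on (- {1}) \<and>
      (\<forall>s. Re s > 1 \<longrightarrow> f s = (\<Sum>n. 1 / of_nat (Suc n) powr s)) \<and> f 1 = 0"
  show "f = zeta_cont"
  proof
    fix z
    show "f z = zeta_cont z"
    proof (cases "z = 1")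
      case False
      show ?thesis
      proof (rule analytic_continuation_open[of "{s. Re s > 1}" "- {1}" f zeta_cont])
        show "connected (- {1 :: complex})" by (rule connected_punctured_universe) simp
        have "2 \<in> {s. Re s > 1}" by simp
        then show "{s. Re s > 1} \<noteq> {}" by blast
      qed (use f Z False in \<open>auto simp: open_halfspace_Re_gt\<close>)
    qed (use f Z in simp)
  qed
qed

text \<open>
  The product defining \<open>xi\<close> agrees with the continuous function \<open>xi_entire\<close> in a punctured
  neighbourhood of every point of the closed right half-plane, so this covers the removed
  singularity at \<open>1\<close> too.
\<close>

lemma xi_eq_xi_entire:
  assumes s: "Re s \<ge> 0"
  shows "xi s = xi_entire s"
  unfolding xi_def
proof (rule remove_sings_eqI)
  have "isCont xi_entire s"
    using holomorphic_on_imp_continuous_on[OF xi_entire_holomorphic[of UNIV]] by (simp add: continuous_on_eq_continuous_at)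
  then have lim: "(xi_entire \<longlongrightarrow> xi_entire s) (at s)" by (simp add: isCont_def)
  have "\<forall>\<^sub>F z in at s. Re z > - 2"
    using s by (intro eventually_at_in_open'[of "{z. Re z > - 2}", simplified]) (auto simp: open_halfspace_Re_gt)
  moreover have "\<forall>\<^sub>F z in at s. z \<noteq> 1" by (rule eventually_neq_at_within)
  ultimately have "\<forall>\<^sub>F z in at s. (z - 1) * of_real pi powr (- z / 2) * zeta z * Gamma (1 + z / 2) = xi_entire z"
  proof eventually_elim
    case (elim z)
    have "1 + z / 2 \<notin> \<int>\<^sub>\<le>\<^sub>0" using elim(1) by (auto elim!: nonpos_Ints_cases simp: complex_eq_iff)
    then have "Gamma (1 + z / 2) * rGamma (1 + z / 2) = 1"
      by (simp add: rGamma_inverse_Gamma Gamma_eq_zero_iff)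
    moreover have "of_real pi powr (- z / 2) * of_real pi powr (z / 2) = (1 :: complex)"
      unfolding pi_powr by (simp flip: exp_add)
    moreover have "(z - 1) * p * (q * r * X / (z - 1)) * g = (g * r) * (p * q) * X" for p q r X g
      using elim(2) by simp
    moreover have "zeta z = of_real pi powr (z / 2) * rGamma (1 + z / 2) * xi_entire z / (z - 1)"
      using elim(2) by (simp add: zeta_eq_zeta_cont zeta_cont_def)
    ultimately show ?case by (simp only: mult_1)
  qed
  then show "((\<lambda>s. (s - 1) * of_real pi powr (- s / 2) * zeta s * Gamma (1 + s / 2)) \<longlongrightarrow> xi_entire s) (at s)"
    using lim tendsto_cong by fast
qed

section \<open>Evaluation of the integral J\<close>

lemma Gamma_vertical_continuous:
  assumes a: "a > 0"
  shows "continuous_on UNIV (\<lambda>v. Gamma (of_real a + \<i> * of_real v))"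
proof (intro continuous_at_imp_continuous_on ballI isCont_Gamma continuous_intros)
  fix v :: real
  show "complex_of_real a + \<i> * of_real v \<notin> \<int>\<^sub>\<le>\<^sub>0"
    using a by (auto elim!: nonpos_Ints_cases simp: complex_eq_iff)
qed

lemma norm_Gamma_le:
  assumes w: "Re w > 0"
  shows "norm (Gamma w) \<le> Gamma (Re w)"
proof -
  have r: "(LBINT y. exp (of_real (Re w) * of_real y - of_real (exp y))) = complex_of_real (Gamma (Re w))"
    using Gamma_integral_exp(2)[of "of_real (Re w)"] w by (simp add: Gamma_complex_of_real)
  have "complex_of_real (LBINT y. norm (exp (w * of_real y - of_real (exp y)))) = of_real (Gamma (Re w))"
    unfolding r[symmetric] integral_complex_of_real[symmetric] by (simp flip: exp_of_real)
  then have "(LBINT y. norm (exp (w * of_real y - of_real (exp y)))) = Gamma (Re w)"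
    by (simp only: of_real_eq_iff)
  then show ?thesis
    using integral_norm_bound[of lborel "\<lambda>y. exp (w * of_real y - of_real (exp y))"]
    by (simp add: Gamma_integral_exp(2)[OF w])
qed

text \<open>
  Quadratic decay suffices, and it comes from \<open>Gamma (w + 2) = (w + 1) * w * Gamma w\<close> together with the
  boundedness of Gamma on a vertical line.
\<close>

lemma Gamma_vertical_integrable:
  assumes a: "a > 0"
  shows "integrable lborel (\<lambda>v. Gamma (of_real a + \<i> * of_real v))"
proof -
  have "integrable lborel (\<lambda>v. Gamma (a + 2) * (1 / (v\<^sup>2 + a\<^sup>2)))"
    by (intro integrable_mult_right lorentzian(1) a)
  then show ?thesis
  proof (rule Bochner_Integration.integrable_bound)
    show "(\<lambda>v. Gamma (of_real a + \<i> * of_real v)) \<in> borel_measurable lborel"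
      using borel_measurable_continuous_onI[OF Gamma_vertical_continuous[OF a]] by simp
    show "AE v in lborel. norm (Gamma (of_real a + \<i> * of_real v)) \<le> norm (Gamma (a + 2) * (1 / (v\<^sup>2 + a\<^sup>2)))"
    proof (intro AE_I2)
      fix v :: real
      define w where "w = of_real a + \<i> * of_real v"
      have w: "Re w = a" "Im w = v" by (auto simp: w_def)
      have np: "w + of_nat k \<notin> \<int>\<^sub>\<le>\<^sub>0" for k
        using a by (auto elim!: nonpos_Ints_cases simp: complex_eq_iff w)
      have nz: "w \<noteq> 0" "w + 1 \<noteq> 0" using a by (auto simp: complex_eq_iff w)
      have "Gamma (w + 2) = (w + 1) * (w * Gamma w)"
        using Gamma_plus1[of w] Gamma_plus1[of "w + 1"] np[of 0] np[of 1] by (simp add: add.assoc)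
      then have "norm (Gamma w) * (norm w * norm (w + 1)) = norm (Gamma (w + 2))"
        by (simp add: norm_mult)
      also have "\<dots> \<le> Gamma (a + 2)" using norm_Gamma_le[of "w + 2"] a by (simp add: w)
      finally have G: "norm (Gamma w) * (norm w * norm (w + 1)) \<le> Gamma (a + 2)" .
      have "v\<^sup>2 + a\<^sup>2 = norm w * norm w"
        by (simp add: cmod_def w power2_eq_square)
      also have "norm w \<le> norm (w + 1)"
        unfolding cmod_def using a by (intro real_sqrt_le_mono add_mono[OF power_mono]) (auto simp: w)
      then have "norm w * norm w \<le> norm w * norm (w + 1)" by (intro mult_left_mono) auto
      finally have "norm (Gamma w) * (v\<^sup>2 + a\<^sup>2) \<le> norm (Gamma w) * (norm w * norm (w + 1))"
        by (intro mult_left_mono) auto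
      with G have "norm (Gamma w) * (v\<^sup>2 + a\<^sup>2) \<le> Gamma (a + 2)" by simp
      moreover have "v\<^sup>2 + a\<^sup>2 > 0" using a by (simp add: add_nonneg_pos)
      ultimately have "norm (Gamma w) \<le> Gamma (a + 2) / (v\<^sup>2 + a\<^sup>2)" by (simp add: pos_le_divide_eq)
      then show "norm (Gamma (of_real a + \<i> * of_real v)) \<le> norm (Gamma (a + 2) * (1 / (v\<^sup>2 + a\<^sup>2)))"
        using Gamma_real_pos[of "a + 2"] a by (simp add: w_def)
    qed
  qed
qed

text \<open>
  Mellin inversion of Euler's integral at the point \<open>exp x\<close>: Fourier inversion for the function
  \<open>y \<mapsto> exp (a y - exp y)\<close>, which is bounded by completing the square in \<open>a y - y\<^sup>2 / 2\<close>.
\<close>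

lemma Gamma_mellin_inversion:
  assumes a: "a > 0"
  shows "(LBINT v. Gamma (of_real a + \<i> * of_real v) * exp (- ((of_real a + \<i> * of_real v) * of_real x))) =
         of_real (2 * pi * exp (- exp x))"
proof -
  define f where "f y = complex_of_real (exp (a * y - exp y))" for y
  define \<Phi> where "\<Phi> v = (LBINT y. iexp (v * y) * f y)" for v
  have fe: "f y = exp (of_real a * of_real y - of_real (exp y))" for y by (simp add: f_def flip: exp_of_real)
  have e: "iexp (v * y) * f y = exp ((of_real a + \<i> * of_real v) * of_real y - of_real (exp y))" for v y
    unfolding fe by (simp add: algebra_simps flip: exp_add)
  have \<Phi>: "\<Phi> v = Gamma (of_real a + \<i> * of_real v)" for v
    unfolding \<Phi>_def e using a by (intro Gamma_integral_exp(2)) simp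
  have int: "integrable lborel f"
    using Gamma_integral_exp(1)[of "of_real a"] a by (simp add: fe[abs_def])
  have bnd: "norm (f y) \<le> exp (a\<^sup>2 / 2)" for y
  proof -
    have "a * y - exp y \<le> a\<^sup>2 / 2"
    proof (cases "y \<ge> 0")
      case True
      have "0 \<le> (a - y)\<^sup>2" by simp
      with exp_lower_Taylor_quadratic[OF True] True show ?thesis by (simp add: power2_diff)
    next
      case False
      then have "a * y \<le> 0" using a by (simp add: mult_nonneg_nonpos)
      then have "a * y - exp y \<le> 0" using exp_ge_zero[of y] by linarith
      also have "0 \<le> a\<^sup>2 / 2" by simp
      finally show ?thesis .
    qed
    then show ?thesis by (simp add: f_def)
  qed
  have "(LBINT v. iexp (- (v * x)) * \<Phi> v) = 2 * pi * f x"
    unfolding \<Phi>_def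
  proof (rule fourier_inversion[OF int _ bnd])
    show "continuous_on UNIV f" unfolding f_def by (intro continuous_intros)
    show "integrable lborel (\<lambda>v. LBINT y. iexp (v * y) * f y)"
      using Gamma_vertical_integrable[OF a] by (simp flip: \<Phi> add: \<Phi>_def)
  qed
  then have 1: "(LBINT v. iexp (- (v * x)) * \<Phi> v) * exp (- (of_real a * of_real x)) = 2 * pi * f x * exp (- (of_real a * of_real x))"
    by simp
  have "Gamma (of_real a + \<i> * of_real v) * exp (- ((of_real a + \<i> * of_real v) * of_real x)) =
        (iexp (- (v * x)) * \<Phi> v) * exp (- (of_real a * of_real x))" for v
  proof -
    have "exp (- ((of_real a + \<i> * of_real v) * of_real x)) = iexp (- (v * x)) * exp (- (of_real a * of_real x))"
      by (simp add: algebra_simps flip: exp_add)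
    then show ?thesis unfolding \<Phi> by (simp only: mult_ac)
  qed
  then have "(LBINT v. Gamma (of_real a + \<i> * of_real v) * exp (- ((of_real a + \<i> * of_real v) * of_real x))) =
        (LBINT v. iexp (- (v * x)) * \<Phi> v) * exp (- (of_real a * of_real x))"
    by simp
  also have "\<dots> = 2 * pi * (f x * exp (- (of_real a * of_real x)))" unfolding 1 by simp
  also have "f x * exp (- (of_real a * of_real x)) = exp (- of_real (exp x))"
    unfolding fe by (simp flip: exp_add)
  also have "complex_of_real (2 * pi) * exp (- of_real (exp x)) = of_real (2 * pi * exp (- exp x))"
    by (simp flip: exp_of_real)
  finally show ?thesis .
qed

text \<open>
  With \<open>w = - c + \<i> v\<close> the rational function in the integrand has the partial fractions
  \<open>M_fun c s v = s / (2 w - 3 + s) + (1 - s) / (2 w - 2 - s)\<close>. Its poles have real part at most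
  \<open>3 / 2 < - c\<close>, so it is the Laplace transform at \<open>w\<close> of the following kernel.
\<close>

definition M_kernel :: "complex \<Rightarrow> real \<Rightarrow> complex" where
  "M_kernel s y = (s * exp ((3 - s) / 2 * of_real y) + (1 - s) * exp ((1 + s / 2) * of_real y)) / 2"

lemma M_fun_eq_integral:
  fixes c v :: real and s :: complex
  defines "w \<equiv> - of_real c + \<i> * of_real v"
  assumes s: "0 \<le> Re s" "Re s \<le> 1" and c: "c < - 3 / 2"
  shows "set_integrable lborel {0<..} (\<lambda>y. exp (- (w * of_real y)) * M_kernel s y)"
    and "M_fun c s v = (LBINT y:{0<..}. exp (- (w * of_real y)) * M_kernel s y)"
    and "norm (M_fun c s v) \<le> (norm s / (- c - (3 - Re s) / 2) + norm (1 - s) / (- c - (1 + Re s / 2))) / 2"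
proof -
  define p q where "p = w - (3 - s) / 2" and "q = w - (1 + s / 2)"
  have Re: "Re p = - c - (3 - Re s) / 2" "Re q = - c - (1 + Re s / 2)" by (auto simp: p_def q_def w_def)
  have pos: "Re p > 0" "Re q > 0" using s c by (auto simp: Re)
  then have nz: "p \<noteq> 0" "q \<noteq> 0" by auto
  have M: "M_fun c s v = s / 2 * (1 / p) + (1 - s) / 2 * (1 / q)"
  proof -
    have iv: "\<i> * of_real v = w + of_real c" by (simp add: w_def)
    have N: "- (2 * s - 1)\<^sup>2 / 2 + 2 * \<i> * of_real v - 2 * (of_real c + 5 / 4) = 2 * (s * q + (1 - s) * p)"
      unfolding mult.assoc iv p_def q_def by (simp add: power2_eq_square field_simps)
    have "- (2 * s - 1)\<^sup>2 / 4 + 2 * \<i> * (2 * \<i> * of_real v - 4 * (of_real c + 5 / 4)) * of_real v + 4 * (of_real c + 5 / 4)\<^sup>2 =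
        - (2 * s - 1)\<^sup>2 / 4 + 2 * (2 * (\<i> * of_real v) - 4 * (of_real c + 5 / 4)) * (\<i> * of_real v) + 4 * (of_real c + 5 / 4)\<^sup>2"
      by (simp only: mult_ac)
    also have "\<dots> = 4 * (p * q)"
      unfolding iv p_def q_def by (simp add: power2_eq_square field_simps)
    finally have "M_fun c s v = 2 * (s * q + (1 - s) * p) / (4 * (p * q))"
      unfolding M_fun_def N by simp
    also have "\<dots> = s / 2 * (1 / p) + (1 - s) / 2 * (1 / q)"
      using nz by (simp add: field_simps)
    finally show ?thesis .
  qed
  have e: "exp (- (w * of_real y)) * M_kernel s y = s / 2 * exp (- (p * of_real y)) + (1 - s) / 2 * exp (- (q * of_real y))" for y
  proof -
    have "exp (- (w * of_real y)) * exp ((3 - s) / 2 * of_real y) = exp (- (p * of_real y))"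
      "exp (- (w * of_real y)) * exp ((1 + s / 2) * of_real y) = exp (- (q * of_real y))"
      by (simp_all add: p_def q_def algebra_simps flip: exp_add)
    moreover have "E * ((s * A + (1 - s) * B) / 2) = s / 2 * (E * A) + (1 - s) / 2 * (E * B)" for E A B
      by (simp add: field_simps)
    ultimately show ?thesis unfolding M_kernel_def by simp
  qed
  note ip = integral_exp_half_line[OF pos(1)] and iq = integral_exp_half_line[OF pos(2)]
  have jp: "set_integrable lborel {0<..} (\<lambda>y. s / 2 * exp (- (p * of_real y)))"
    and jq: "set_integrable lborel {0<..} (\<lambda>y. (1 - s) / 2 * exp (- (q * of_real y)))"
    using ip(1) iq(1) by (intro set_integrable_mult_right; simp)+
  show "set_integrable lborel {0<..} (\<lambda>y. exp (- (w * of_real y)) * M_kernel s y)"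
    unfolding e by (rule set_integral_add(1)[OF jp jq])
  show "M_fun c s v = (LBINT y:{0<..}. exp (- (w * of_real y)) * M_kernel s y)"
    unfolding e set_integral_add(2)[OF jp jq] M by (simp only: set_integral_mult_right ip(2) iq(2))
  have "norm (M_fun c s v) \<le> norm (s / 2 * (1 / p)) + norm ((1 - s) / 2 * (1 / q))"
    unfolding M by (rule norm_triangle_ineq)
  also have "\<dots> = (norm s / norm p + norm (1 - s) / norm q) / 2"
    by (simp add: norm_mult norm_divide add_divide_distrib)
  also have "\<dots> \<le> (norm s / Re p + norm (1 - s) / Re q) / 2"
    using pos nz by (intro divide_right_mono add_mono divide_left_mono complex_Re_le_cmod mult_pos_pos) auto
  finally show "norm (M_fun c s v) \<le> (norm s / (- c - (3 - Re s) / 2) + norm (1 - s) / (- c - (1 + Re s / 2))) / 2"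
    unfolding Re .
qed

text \<open>
  The contribution of one term of the Dirichlet series of zeta. Writing \<open>M_fun\<close> as a Laplace transform
  and exchanging the integrals leaves an inner integral to which Mellin inversion applies.
\<close>

lemma J_term_mellin:
  fixes c :: real and s :: complex
  assumes s: "0 \<le> Re s" "Re s \<le> 1" and c: "c < - 3 / 2" and A: "A > 0"
  shows "(LBINT v. Gamma (- of_real c + \<i> * of_real v) *
            exp (- ((- of_real c + \<i> * of_real v) * of_real (ln A))) * M_fun c s v) =
         2 * pi * (LBINT y:{0<..}. exp (- of_real (A * exp y)) * M_kernel s y)"
proof -
  define w where "w v = - complex_of_real c + \<i> * of_real v" for v
  have w: "w v = of_real (- c) + \<i> * of_real v" for v by (simp add: w_def)
  have c0: "- c > 0" using c by simp
  define h where "h v y = Gamma (w v) * exp (- (w v * of_real (ln A))) *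
     (indicator {0<..} y *\<^sub>R (exp (- (w v * of_real y)) * M_kernel s y))" for v y
  define m where "m y = indicator {0<..} y *\<^sub>R (exp (- (w 0 * of_real y)) * M_kernel s y)" for y
  have [measurable]: "(\<lambda>v. Gamma (w v)) \<in> borel_measurable borel"
    unfolding w using borel_measurable_continuous_onI[OF Gamma_vertical_continuous[OF c0]] .
  have [measurable]: "w \<in> borel_measurable borel" unfolding w_def by measurable
  have [measurable]: "M_kernel s \<in> borel_measurable borel" unfolding M_kernel_def by measurable
  have nh: "norm (h v y) = (exp (c * ln A) * norm (Gamma (w v))) * norm (m y)" for v y
    by (simp add: h_def m_def w_def norm_mult)
  have im: "integrable lborel m"
    using M_fun_eq_integral(1)[OF s c, of 0] unfolding m_def w_def set_integrable_def .
  have iG: "integrable lborel (\<lambda>v. Gamma (w v))"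
    unfolding w by (rule Gamma_vertical_integrable[OF c0])
  have hm [measurable]: "case_prod h \<in> borel_measurable (lborel \<Otimes>\<^sub>M lborel)"
    unfolding h_def by measurable
  have ih: "integrable lborel (h v)" for v
    using M_fun_eq_integral(1)[OF s c, of v] unfolding h_def w_def set_integrable_def
    by (intro integrable_mult_right)
  have "integrable (lborel \<Otimes>\<^sub>M lborel) (case_prod h)"
  proof (rule lborel_pair.Fubini_integrable[OF hm])
    show "integrable lborel (\<lambda>v. LBINT y. norm (case_prod h (v, y)))"
      using iG by (auto simp: nh)
  qed (use ih in auto)
  then have fub: "(LBINT y. LBINT v. h v y) = (LBINT v. LBINT y. h v y)"
    by (rule lborel_pair.Fubini_integral)
  have i1: "(LBINT y. h v y) = Gamma (w v) * exp (- (w v * of_real (ln A))) * M_fun c s v" for v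
    unfolding M_fun_eq_integral(2)[OF s c] h_def integral_mult_right_zero set_lebesgue_integral_def w_def ..
  have i2: "(LBINT v. h v y) = indicator {0<..} y *\<^sub>R (complex_of_real (2 * pi) * (exp (- of_real (A * exp y)) * M_kernel s y))" for y
  proof -
    have "h v y = (Gamma (w v) * exp (- (w v * of_real (ln A + y)))) * (indicator {0<..} y *\<^sub>R M_kernel s y)" for v
    proof -
      have "exp (- (w v * of_real (ln A + y))) = exp (- (w v * of_real (ln A))) * exp (- (w v * of_real y))"
        by (simp add: algebra_simps flip: exp_add)
      then show ?thesis by (simp add: h_def scaleR_conv_of_real)
    qed
    then have "(LBINT v. h v y) = (LBINT v. Gamma (w v) * exp (- (w v * of_real (ln A + y)))) * (indicator {0<..} y *\<^sub>R M_kernel s y)"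
      by (simp only: integral_mult_left_zero)
    also have "(LBINT v. Gamma (w v) * exp (- (w v * of_real (ln A + y)))) = of_real (2 * pi * exp (- exp (ln A + y)))"
      unfolding w by (rule Gamma_mellin_inversion[OF c0])
    also have "\<dots> = of_real (2 * pi) * exp (- of_real (A * exp y))"
      using A by (simp add: exp_add flip: exp_of_real)
    finally show ?thesis by (simp add: scaleR_conv_of_real)
  qed
  have "(LBINT v. Gamma (w v) * exp (- (w v * of_real (ln A))) * M_fun c s v) =
        (LBINT y. indicator {0<..} y *\<^sub>R (complex_of_real (2 * pi) * (exp (- of_real (A * exp y)) * M_kernel s y)))"
    using fub unfolding i1 i2 by simp
  also have "\<dots> = (LBINT y:{0<..}. complex_of_real (2 * pi) * (exp (- of_real (A * exp y)) * M_kernel s y))"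
    by (simp only: set_lebesgue_integral_def)
  also have "\<dots> = 2 * pi * (LBINT y:{0<..}. exp (- of_real (A * exp y)) * M_kernel s y)"
    by (rule set_integral_mult_right)
  finally show ?thesis by (simp only: w_def)
qed

text \<open>
  The reduced kernel is \<open>2 * exp (- y) * M_kernel s y\<close>, that is
  \<open>s * exp ((1 - s) / 2 * y) + (1 - s) * exp (s / 2 * y)\<close>; its value at \<open>0\<close> is \<open>1\<close>.
\<close>

definition reduced_kernel_deriv :: "complex \<Rightarrow> real \<Rightarrow> complex" where
  "reduced_kernel_deriv s y = s * (1 - s) / 2 * (exp (s / 2 * of_real y) + exp ((1 - s) / 2 * of_real y))"

text \<open>
  Integration by parts. Up to sign the factor \<open>A exp y * exp (- A exp y)\<close> is the derivative of \<open>exp (- A exp y)\<close>, and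
  the boundary term at \<open>y = 0\<close> is what eventually sums to \<open>psi 1\<close>.
\<close>

lemma J_term_parts:
  fixes s :: complex
  assumes A: "A > 0"
  shows "2 * of_real A * (LBINT y:{0<..}. exp (- of_real (A * exp y)) * M_kernel s y) =
         exp (- of_real A) + (LBINT y:{0<..}. exp (- of_real (A * exp y)) * reduced_kernel_deriv s y)"
    and "set_integrable lborel {0<..} (\<lambda>y. exp (- of_real (A * exp y)) * reduced_kernel_deriv s y)"
proof -
  define E where "E w y = exp (w * of_real y - of_real (A * exp y))" for w :: complex and y :: real
  have iE: "set_integrable lborel {0<..} (E w)" for w unfolding E_def by (rule set_integrable_exp_exp[OF A])
  have eE: "exp (- of_real (A * exp y)) * exp (w * of_real y) = E w y" for w y
    by (simp add: E_def flip: exp_add)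
  have k: "exp (- of_real (A * exp y)) * M_kernel s y = s / 2 * E ((3 - s) / 2) y + (1 - s) / 2 * E (1 + s / 2) y" for y
    unfolding M_kernel_def eE[symmetric] by (simp add: field_simps)
  have gd: "exp (- of_real (A * exp y)) * reduced_kernel_deriv s y = s * (1 - s) / 2 * E (s / 2) y + s * (1 - s) / 2 * E ((1 - s) / 2) y" for y
    unfolding reduced_kernel_deriv_def eE[symmetric] by (simp add: algebra_simps)
  have iEm: "set_integrable lborel {0<..} (\<lambda>y. u * E w y)" for u w using iE by (intro set_integrable_mult_right) auto
  have ik: "set_integrable lborel {0<..} (\<lambda>y. exp (- of_real (A * exp y)) * M_kernel s y)"
    unfolding k by (intro set_integral_add(1) iEm)
  show ig: "set_integrable lborel {0<..} (\<lambda>y. exp (- of_real (A * exp y)) * reduced_kernel_deriv s y)"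
    unfolding gd by (intro set_integral_add(1) iEm)
  have ik2: "set_integrable lborel {0<..} (\<lambda>y. 2 * of_real A * (exp (- of_real (A * exp y)) * M_kernel s y))"
    using ik by (intro set_integrable_mult_right) auto
  \<comment> \<open>minus \<open>exp (- A exp y)\<close> times the reduced kernel\<close>
  define F where "F y = - (s * E ((1 - s) / 2) y + (1 - s) * E (s / 2) y)" for y
  define f where "f y = 2 * of_real A * (exp (- of_real (A * exp y)) * M_kernel s y) - exp (- of_real (A * exp y)) * reduced_kernel_deriv s y" for y
  have dE: "(E w has_vector_derivative (w * E w y - of_real A * E (w + 1) y)) (at y)" for w y
  proof -
    have "((\<lambda>z. exp (w * z - of_real A * exp z)) has_field_derivative
        exp (w * of_real y - of_real A * exp (of_real y)) * (w - of_real A * exp (of_real y))) (at (of_real y))"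
      by (auto intro!: derivative_eq_intros)
    from has_vector_derivative_real_field[OF this]
    have "(E w has_vector_derivative E w y * (w - of_real A * exp (of_real y))) (at y)"
      by (simp add: E_def[abs_def] flip: exp_of_real)
    moreover have "E w y * (w - of_real A * exp (of_real y)) = w * E w y - of_real A * E (w + 1) y"
    proof -
      have "E (w + 1) y = E w y * exp (of_real y)" by (simp add: E_def algebra_simps flip: exp_add)
      then show ?thesis by (simp add: algebra_simps)
    qed
    ultimately show ?thesis by simp
  qed
  have dF: "(F has_vector_derivative f y) (at y)" for y
  proof -
    have "(F has_vector_derivative - (s * ((1 - s) / 2 * E ((1 - s) / 2) y - of_real A * E ((1 - s) / 2 + 1) y) +
        (1 - s) * (s / 2 * E (s / 2) y - of_real A * E (s / 2 + 1) y))) (at y)"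
      unfolding F_def by (intro derivative_intros has_vector_derivative_mult_right dE)
    moreover have "(1 - s) / 2 + 1 = (3 - s) / 2" "s / 2 + 1 = 1 + s / 2" by (simp_all add: field_simps)
    moreover have "2 * a * (s / 2 * u + (1 - s) / 2 * v) - (s * (1 - s) / 2 * x + s * (1 - s) / 2 * z) =
        - (s * ((1 - s) / 2 * z - a * u) + (1 - s) * (s / 2 * x - a * v))" for a u v x z
      by (simp add: field_simps)
    ultimately show ?thesis unfolding f_def k gd by (simp only:)
  qed
  have ei: "einterval 0 \<infinity> = {0<..}" by (auto simp: einterval_def)
  have isf: "set_integrable lborel {0<..} f" unfolding f_def by (rule set_integral_diff(1)[OF ik2 ig])
  have cE: "isCont (E w) y" for w y using dE by (rule has_vector_derivative_continuous)
  have t0: "((F \<circ> real_of_ereal) \<longlongrightarrow> - exp (- of_real A)) (at_right 0)"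
  proof -
    have "isCont F 0" unfolding F_def by (intro continuous_intros cE)
    then have "(F \<longlongrightarrow> F 0) (at_right 0)" by (simp add: isCont_def filterlim_at_split)
    moreover have "F 0 = - exp (- of_real A)" by (simp add: F_def E_def algebra_simps)
    ultimately show ?thesis unfolding zero_ereal_def by (simp only: ereal_tendsto_simps)
  qed
  have tE: "(E w \<longlongrightarrow> 0) at_top" for w
  proof (rule tendsto_norm_zero_cancel)
    have "((\<lambda>y. exp (Re w * y - A * exp y)) \<longlongrightarrow> 0) at_top"
      using A by real_asymp
    then show "((\<lambda>y. norm (E w y)) \<longlongrightarrow> 0) at_top" by (simp add: E_def)
  qed
  have t1: "((F \<circ> real_of_ereal) \<longlongrightarrow> 0) (at_left \<infinity>)"
  proof -
    have "(F \<longlongrightarrow> - (s * 0 + (1 - s) * 0)) at_top" unfolding F_def by (intro tendsto_intros tE)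
    then show ?thesis by (simp only: ereal_tendsto_simps) simp
  qed
  have cf: "isCont f y" for y
    unfolding f_def k gd by (intro continuous_intros cE)
  have "(LBINT y=0..\<infinity>. f y) = 0 - (- exp (- of_real A))"
    by (rule interval_integral_FTC_integrable[OF _ dF cf _ t0 t1]) (use isf ei in auto)
  then have "(LBINT y:{0<..}. f y) = exp (- of_real A)"
    by (simp add: interval_lebesgue_integral_def ei)
  moreover have "(LBINT y:{0<..}. f y) = 2 * of_real A * (LBINT y:{0<..}. exp (- of_real (A * exp y)) * M_kernel s y) -
       (LBINT y:{0<..}. exp (- of_real (A * exp y)) * reduced_kernel_deriv s y)"
    unfolding f_def set_integral_diff(2)[OF ik2 ig] by simp
  ultimately show "2 * of_real A * (LBINT y:{0<..}. exp (- of_real (A * exp y)) * M_kernel s y) =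
         exp (- of_real A) + (LBINT y:{0<..}. exp (- of_real (A * exp y)) * reduced_kernel_deriv s y)"
    by (simp add: algebra_simps)
qed

lemma reduced_kernel_deriv_sums:
  fixes s :: complex
  shows "(\<lambda>n. LBINT y:{0<..}. exp (- of_real (pi * (real (Suc n))\<^sup>2 * exp y)) * reduced_kernel_deriv s y) sums
         (s * (1 - s) / 2 * (psi_mellin (s / 2) + psi_mellin ((1 - s) / 2)))"
proof -
  define f where "f n y = indicator {0<..} y *\<^sub>R (exp (- complex_of_real (pi * (real (Suc n))\<^sup>2 * exp y)) * reduced_kernel_deriv s y)" for n y
  define F where "F y = indicator {0<..} y *\<^sub>R (complex_of_real (psi (exp y)) * reduced_kernel_deriv s y)" for y
  have [measurable]: "reduced_kernel_deriv s \<in> borel_measurable borel" unfolding reduced_kernel_deriv_def by measurable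
  define B where "B z y = complex_of_real (psi (exp y)) * exp (z * of_real y)" for z :: complex and y :: real
  have iB: "set_integrable lborel {0<..} (\<lambda>y. u * B z y)" for u z
    using psi_mellin_integrable[of z] unfolding B_def by (intro set_integrable_mult_right) auto
  have Fe: "complex_of_real (psi (exp y)) * reduced_kernel_deriv s y = s * (1 - s) / 2 * B (s / 2) y + s * (1 - s) / 2 * B ((1 - s) / 2) y" for y
    by (simp add: B_def reduced_kernel_deriv_def algebra_simps)
  have iF: "integrable lborel F"
    using set_integral_add(1)[OF iB iB] unfolding F_def Fe set_integrable_def .
  have vF: "(LBINT y. F y) = s * (1 - s) / 2 * (psi_mellin (s / 2) + psi_mellin ((1 - s) / 2))"
  proof -
    have "(LBINT y:{0<..}. u * B z y) = u * psi_mellin z" for u z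
      by (simp only: set_integral_mult_right B_def psi_mellin_def)
    then show ?thesis
      using set_integral_add(2)[OF iB iB] unfolding F_def Fe set_lebesgue_integral_def[symmetric]
      by (simp only: distrib_left)
  qed
  have ps: "(\<lambda>n. exp (- (pi * (real (Suc n))\<^sup>2 * exp y))) sums psi (exp y)" for y by (rule sums_psi) simp
  have nf: "norm (f n y) = exp (- (pi * (real (Suc n))\<^sup>2 * exp y)) * (indicator {0<..} y * norm (reduced_kernel_deriv s y))" for n y
    by (simp add: f_def norm_mult indicator_def)
  have nF: "norm (F y) = psi (exp y) * (indicator {0<..} y * norm (reduced_kernel_deriv s y))" for y
    by (simp add: F_def norm_mult indicator_def psi_nonneg)
  have "(\<lambda>n. LBINT y. f n y) sums (LBINT y. F y)"
  proof (rule sums_integral_dominated(2)[where m = "\<lambda>y. norm (F y)"])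
    show "f k \<in> borel_measurable lborel" for k unfolding f_def by measurable
    show "integrable lborel (\<lambda>y. norm (F y))" using iF by simp
    show "(\<Sum>k<n. norm (f k y)) \<le> norm (F y)" for n y
    proof -
      have "(\<Sum>k<n. exp (- (pi * (real (Suc k))\<^sup>2 * exp y))) \<le> psi (exp y)"
        using sum_le_suminf[OF sums_summable[OF ps[of y]], of "{..<n}"] sums_unique[OF ps[of y]] by simp
      then show ?thesis unfolding nf nF sum_distrib_right[symmetric] by (intro mult_right_mono) auto
    qed
    show "(\<lambda>k. f k y) sums F y" for y
    proof -
      have "(\<lambda>n. complex_of_real (exp (- (pi * (real (Suc n))\<^sup>2 * exp y))) * reduced_kernel_deriv s y) sums
            (complex_of_real (psi (exp y)) * reduced_kernel_deriv s y)"
        by (intro sums_mult2 sums_of_real ps)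
      then have "(\<lambda>n. indicator {0<..} y *\<^sub>R (complex_of_real (exp (- (pi * (real (Suc n))\<^sup>2 * exp y))) * reduced_kernel_deriv s y)) sums F y"
        unfolding F_def by (intro sums_scaleR_right)
      then show ?thesis unfolding f_def by (simp only: exp_of_real[symmetric] of_real_minus)
    qed
  qed
  then show ?thesis unfolding vF f_def set_lebesgue_integral_def[symmetric] .
qed

text \<open>
  Since \<open>- 2 c - 2 > 1\<close>, zeta is given by its Dirichlet series along the whole line of integration, and
  the bound on \<open>M_fun\<close> and the integrability of Gamma dominate the termwise integration.
\<close>

theorem J_closed_form:
  fixes s :: complex and c :: real
  assumes s: "0 \<le> Re s" "Re s \<le> 1" and c: "c < - 3 / 2"
  shows "integrable lborel (J_integrand s c)"
    and "J s c = of_real (psi 1) + s * (1 - s) / 2 * (psi_mellin (s / 2) + psi_mellin ((1 - s) / 2))"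
proof -
  define w where "w v = - complex_of_real c + \<i> * of_real v" for v
  have w: "w v = of_real (- c) + \<i> * of_real v" for v by (simp add: w_def)
  have c0: "- c > 0" using c by simp
  define A where "A n = pi * (real (Suc n))\<^sup>2" for n
  have A: "A n > 0" for n by (simp add: A_def)
  define f where "f n v = of_real ((real (Suc n))\<^sup>2) * (Gamma (w v) * exp (- (w v * of_real (ln (A n)))) * M_fun c s v)" for n v
  have [measurable]: "(\<lambda>v. Gamma (w v)) \<in> borel_measurable borel"
    unfolding w using borel_measurable_continuous_onI[OF Gamma_vertical_continuous[OF c0]] .
  have [measurable]: "w \<in> borel_measurable borel" unfolding w_def by measurable
  have [measurable]: "M_fun c s \<in> borel_measurable borel" unfolding M_fun_def by measurable
  have Js: "(\<lambda>n. f n v) sums J_integrand s c v" for v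
  proof -
    have z: "- 2 * of_real c + 2 * \<i> * of_real v - 2 = 2 * w v - 2" by (simp add: w_def)
    have "(\<lambda>n. 1 / of_nat (Suc n) powr (2 * w v - 2)) sums zeta (2 * w v - 2)"
      unfolding zeta_eq_zeta_cont using c by (intro zeta_cont_dirichlet) (simp add: w_def)
    then have "(\<lambda>n. exp (- (w v * of_real (ln pi))) * (1 / of_nat (Suc n) powr (2 * w v - 2)) * (Gamma (w v) * M_fun c s v))
       sums (exp (- (w v * of_real (ln pi))) * zeta (2 * w v - 2) * (Gamma (w v) * M_fun c s v))"
      by (intro sums_mult sums_mult2)
    moreover have "exp (- (w v * of_real (ln pi))) * (1 / of_nat (Suc n) powr (2 * w v - 2)) =
        of_real ((real (Suc n))\<^sup>2) * exp (- (w v * of_real (ln (A n))))" for n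
    proof -
      define l where "l = complex_of_real (ln (real (Suc n)))"
      have 1: "of_nat (Suc n) powr (2 * w v - 2) = exp ((2 * w v - 2) * l)"
        by (simp add: powr_def Ln_of_nat l_def del: of_nat_Suc)
      have "ln (A n) = ln pi + 2 * ln (real (Suc n))"
        by (simp add: A_def ln_mult ln_realpow del: of_nat_Suc)
      then have 2: "exp (- (w v * of_real (ln (A n)))) = exp (- (w v * of_real (ln pi)) - 2 * w v * l)"
        by (simp add: l_def algebra_simps)
      have "complex_of_real ((real (Suc n))\<^sup>2) = exp l * exp l"
        by (simp add: l_def power2_eq_square exp_of_real del: of_nat_Suc)
      then have 3: "complex_of_real ((real (Suc n))\<^sup>2) = exp (2 * l)" by (simp flip: exp_add)
      show ?thesis unfolding 1 2 3 divide_inverse exp_minus[symmetric] by (simp add: algebra_simps flip: exp_add)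
    qed
    ultimately have "(\<lambda>n. f n v) sums (exp (- (w v * of_real (ln pi))) * zeta (2 * w v - 2) * (Gamma (w v) * M_fun c s v))"
      unfolding f_def by (simp only: mult_ac)
    moreover have "J_integrand s c v = exp (- (w v * of_real (ln pi))) * zeta (2 * w v - 2) * (Gamma (w v) * M_fun c s v)"
    proof -
      have "complex_of_real c - \<i> * of_real v = - w v" by (simp add: w_def)
      then show ?thesis unfolding J_integrand_def z pi_powr w_def[symmetric] by (simp only: mult_ac mult_minus_left)
    qed
    ultimately show ?thesis by simp
  qed
  define K where "K = (norm s / (- c - (3 - Re s) / 2) + norm (1 - s) / (- c - (1 + Re s / 2))) / 2"
  have K: "norm (M_fun c s v) \<le> K" for v
    unfolding K_def by (rule M_fun_eq_integral(3)[OF s c])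
  have K0: "K \<ge> 0" using K[of 0] norm_ge_zero order_trans by blast
  \<comment> \<open>the absolute value of \<open>(n + 1)\<^sup>2 exp (- w ln (A n))\<close>, because \<open>Re w = - c\<close>\<close>
  define r where "r n = (real (Suc n))\<^sup>2 * exp (c * ln (A n))" for n
  have r: "summable r"
  proof -
    have "r = (\<lambda>n. exp (- ((- c - 1) * ln (pi * (real (Suc n))\<^sup>2))) / pi)"
    proof
      fix n
      have "A n = exp (ln (A n))" using A by simp
      then have "(real (Suc n))\<^sup>2 = exp (ln (A n)) / pi" by (simp add: A_def)
      then have "r n = exp (ln (A n)) * exp (c * ln (A n)) / pi" unfolding r_def by simp
      also have "exp (ln (A n)) * exp (c * ln (A n)) = exp (- ((- c - 1) * ln (A n)))"
        unfolding exp_add[symmetric] by (simp add: algebra_simps)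
      finally show "r n = exp (- ((- c - 1) * ln (pi * (real (Suc n))\<^sup>2))) / pi" by (simp only: A_def)
    qed
    moreover have "summable (\<lambda>n. exp (- ((- c - 1) * ln (pi * (real (Suc n))\<^sup>2))))"
      using c by (intro dirichlet_summable) auto
    ultimately show ?thesis by (simp only: summable_divide)
  qed
  have nf: "norm (f n v) \<le> r n * (norm (Gamma (w v)) * K)" for n v
  proof -
    have "norm (f n v) = r n * (norm (Gamma (w v)) * norm (M_fun c s v))"
      by (simp add: f_def r_def norm_mult norm_power w_def del: of_nat_Suc)
    also have "\<dots> \<le> r n * (norm (Gamma (w v)) * K)"
      by (intro mult_left_mono K) (auto simp: r_def)
    finally show ?thesis .
  qed
  have im: "integrable lborel (\<lambda>v. suminf r * (norm (Gamma (w v)) * K))"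
    using Gamma_vertical_integrable[OF c0] unfolding w by (intro integrable_mult_right integrable_mult_left integrable_norm)
  have dom: "(\<Sum>k<n. norm (f k v)) \<le> suminf r * (norm (Gamma (w v)) * K)" for n v
  proof -
    have "(\<Sum>k<n. norm (f k v)) \<le> (\<Sum>k<n. r k * (norm (Gamma (w v)) * K))" by (intro sum_mono nf)
    also have "\<dots> = (\<Sum>k<n. r k) * (norm (Gamma (w v)) * K)" by (simp add: sum_distrib_right)
    also have "\<dots> \<le> suminf r * (norm (Gamma (w v)) * K)"
      using K0 by (intro mult_right_mono sum_le_suminf r) (auto simp: r_def)
    finally show ?thesis .
  qed
  have fm: "f k \<in> borel_measurable lborel" for k unfolding f_def by measurable
  note D = sums_integral_dominated[OF fm im dom Js]
  show "integrable lborel (J_integrand s c)" by (rule D(1))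
  have "(LBINT v. f n v) = exp (- of_real (A n)) + (LBINT y:{0<..}. exp (- of_real (A n * exp y)) * reduced_kernel_deriv s y)" for n
  proof -
    have "(LBINT v. f n v) = of_real ((real (Suc n))\<^sup>2) * (2 * pi * (LBINT y:{0<..}. exp (- of_real (A n * exp y)) * M_kernel s y))"
      unfolding f_def integral_mult_right_zero w_def J_term_mellin[OF s c A] ..
    also have "\<dots> = 2 * of_real (A n) * (LBINT y:{0<..}. exp (- of_real (A n * exp y)) * M_kernel s y)"
      by (simp add: A_def del: of_nat_Suc)
    finally show ?thesis unfolding J_term_parts(1)[OF A] .
  qed
  with D(2) have 1: "(\<lambda>n. exp (- of_real (A n)) + (LBINT y:{0<..}. exp (- of_real (A n * exp y)) * reduced_kernel_deriv s y)) sums J s c"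
    by (simp only: J_def)
  have "(\<lambda>n. complex_of_real (exp (- (pi * (real (Suc n))\<^sup>2 * 1)))) sums of_real (psi 1)"
    by (intro sums_of_real sums_psi) simp
  then have "(\<lambda>n. exp (- complex_of_real (A n))) sums of_real (psi 1)"
    by (simp only: A_def exp_of_real[symmetric] of_real_minus mult_1_right)
  from sums_add[OF this reduced_kernel_deriv_sums[of s]]
  show "J s c = of_real (psi 1) + s * (1 - s) / 2 * (psi_mellin (s / 2) + psi_mellin ((1 - s) / 2))"
    unfolding A_def[symmetric] by (rule sums_unique2[OF 1])
qed

theorem mainTheorem1:
  fixes s :: complex and c :: real
  assumes "0 \<le> Re s" and "Re s \<le> 1"
    and "c < - 3 / 2"
  shows "integrable lborel (J_integrand s c) \<and>
         xi s = of_real (pi powr (1 / 4) / (2 * Gamma (3 / 4))) - J s c"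
proof
  show "integrable lborel (J_integrand s c)" by (rule J_closed_form(1)[OF assms])
  have "1 / 2 + psi 1 = theta 1 / 2"
    by (simp add: psi_eq diff_divide_distrib)
  then have "complex_of_real (1 / 2 + psi 1) = of_real (theta 1 / 2)"
    by (simp only:)
  also have "theta 1 / 2 = pi powr (1 / 4) / (2 * Gamma (3 / 4))"
    by (simp add: theta_at_1)
  finally have "1 / 2 + complex_of_real (psi 1) = of_real (pi powr (1 / 4) / (2 * Gamma (3 / 4)))"
    by simp
  note const = this
  show "xi s = of_real (pi powr (1 / 4) / (2 * Gamma (3 / 4))) - J s c"
    unfolding xi_eq_xi_entire[OF assms(1)] xi_entire_def J_closed_form(2)[OF assms] const[symmetric] by simp
qed

end
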